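(* Let $\psi$ be a Ma-Minda function, let $K\ge 1$, $k=(K-1)/(K+1)$, and let $h(z)=f(z)+\overline{g(z)}=z+\sum_{m=2}^{\infty}a_mz^m+\overline{\sum_{m=1}^{\infty}b_mz^m}$ be a sense-preserving $K$-quasiconformal harmonic mapping on the unit disk $\mathbb{D}$ with $f\in\mathcal{C}(\psi)$. Let $h_1(z)=f_1(z)+\overline{g_1(z)}=z+\sum_{m=2}^{\infty}c_mz^m+\overline{\sum_{m=1}^{\infty}d_mz^m}$ be a harmonic function with $h_1\prec h$, and put $c_1=1$. Then $$\sum_{m=1}^{\infty}(|c_m|+|d_m|)r^m\le d(f(0),\partial f(\mathbb{D}))$$ holds for all $0\le r\le r^*=\min\{r_0,\tfrac13\}$, where $r_0$ is the unique root in $(0,1)$ of $$\frac{2K}{K+1}\hat f_0(r)=-f_0(-1),$$ and $f_0\in\mathcal{A}$ is the solution of $1+zf_0''(z)/f_0'(z)=\psi(z)$. Moreover, if $\hat f_0=f_0$ and $r^*=r_0$, the result is sharp: for $h=h_1=p$ with $p(z)=f_0(z)+k\overline{f_0(z)}$, equality holds at $r=r_0$, so the radius cannot be increased.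
   Context: $\mathbb{D}=\{|z|<1\}$. $\mathcal{A}$ is the class of analytic functions $f(z)=z+\sum_{m\ge2}a_mz^m$ on $\mathbb{D}$. A Ma-Minda function is an analytic univalent function $\psi$ on $\mathbb{D}$ with $\Re\psi>0$, $\psi(0)=1$, $\psi'(0)>0$, and $\psi(\mathbb{D})$ symmetric about the real axis. A function $u$ (analytic or harmonic) is subordinate to $v$, written $u\prec v$, if $u=v\circ w$ for a Schwarz function $w$ (analytic $w:\mathbb{D}\to\mathbb{D}$ with $w(0)=0$). $\mathcal{C}(\psi)=\{f\in\mathcal{A}: 1+zf''(z)/f'(z)\prec\psi(z)\}$. A harmonic function on $\mathbb{D}$ is written $h=f+\overline g$ with $f,g$ analytic and $g(0)=0$. It is sense-preserving if $|f'|^2-|g'|^2>0$ in $\mathbb{D}$. For $K\ge1$, a sense-preserving $K$-quasiconformal harmonic mapping is a harmonic, sense-preserving homeomorphism $h=f+\overline g$ of $\mathbb{D}$ onto its image whose dilatation satisfies $|g'/f'|\le k=(K-1)/(K+1)$ in $\mathbb{D}$. If $f_0(z)=z+\sum_{m\ge2}t_mz^m$, then $\hat f_0(r)=r+\sum_{m\ge2}|t_m|r^m$. The value $f_0(-1)$ means $\lim_{r\to1^-}f_0(-r)$. $d(f(0),\partial f(\mathbb{D}))$ is the Euclidean distance from $f(0)$ to the boundary of $f(\mathbb{D})$. *)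

theory Defs
  imports "HOL-Complex_Analysis.Complex_Analysis"
begin

abbreviation unit_disc :: "complex set" where
  "unit_disc \<equiv> ball 0 1"

definition classA :: "(complex \<Rightarrow> complex) \<Rightarrow> bool" where
  "classA f \<longleftrightarrow> f holomorphic_on unit_disc \<and> f 0 = 0 \<and> deriv f 0 = 1"

definition ma_minda :: "(complex \<Rightarrow> complex) \<Rightarrow> bool" where
  "ma_minda \<psi> \<longleftrightarrow>
     \<psi> holomorphic_on unit_disc \<and> inj_on \<psi> unit_disc \<and>
     (\<forall>z\<in>unit_disc. 0 < Re (\<psi> z)) \<and>
     \<psi> 0 = 1 \<and>
     Im (deriv \<psi> 0) = 0 \<and> 0 < Re (deriv \<psi> 0) \<and>
     (\<forall>w\<in>\<psi> ` unit_disc. cnj w \<in> \<psi> ` unit_disc)"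

definition schwarz_function :: "(complex \<Rightarrow> complex) \<Rightarrow> bool" where
  "schwarz_function w \<longleftrightarrow> w holomorphic_on unit_disc \<and> w ` unit_disc \<subseteq> unit_disc \<and> w 0 = 0"

definition subordinate :: "(complex \<Rightarrow> complex) \<Rightarrow> (complex \<Rightarrow> complex) \<Rightarrow> bool" where
  "subordinate u v \<longleftrightarrow> (\<exists>w. schwarz_function w \<and> (\<forall>z\<in>unit_disc. u z = v (w z)))"

definition convexity_quotient :: "(complex \<Rightarrow> complex) \<Rightarrow> complex \<Rightarrow> complex" where
  "convexity_quotient f z = 1 + z * deriv (deriv f) z / deriv f z"

(* The condition that the derivative does not vanish, here and in convex_extremal, only says
   that the quotient is defined on the disc; in HOL a quotient by 0 would be 0. *)
definition classC :: "(complex \<Rightarrow> complex) \<Rightarrow> (complex \<Rightarrow> complex) \<Rightarrow> bool" where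
  "classC \<psi> f \<longleftrightarrow>
     classA f \<and> (\<forall>z\<in>unit_disc. deriv f z \<noteq> 0) \<and> subordinate (convexity_quotient f) \<psi>"

definition convex_extremal :: "(complex \<Rightarrow> complex) \<Rightarrow> (complex \<Rightarrow> complex) \<Rightarrow> bool" where
  "convex_extremal \<psi> f0 \<longleftrightarrow>
     classA f0 \<and> (\<forall>z\<in>unit_disc. deriv f0 z \<noteq> 0 \<and> convexity_quotient f0 z = \<psi> z)"

definition harmonic_decomp ::
    "(complex \<Rightarrow> complex) \<Rightarrow> (complex \<Rightarrow> complex) \<Rightarrow> (complex \<Rightarrow> complex) \<Rightarrow> bool" where
  "harmonic_decomp h f g \<longleftrightarrow>
     f holomorphic_on unit_disc \<and> g holomorphic_on unit_disc \<and> g 0 = 0 \<and>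
     (\<forall>z\<in>unit_disc. h z = f z + cnj (g z))"

definition sense_preserving :: "(complex \<Rightarrow> complex) \<Rightarrow> (complex \<Rightarrow> complex) \<Rightarrow> bool" where
  "sense_preserving f g \<longleftrightarrow> (\<forall>z\<in>unit_disc. (cmod (deriv f z))\<^sup>2 - (cmod (deriv g z))\<^sup>2 > 0)"

definition qc_harmonic ::
    "real \<Rightarrow> (complex \<Rightarrow> complex) \<Rightarrow> (complex \<Rightarrow> complex) \<Rightarrow> (complex \<Rightarrow> complex) \<Rightarrow> bool" where
  "qc_harmonic K h f g \<longleftrightarrow>
     harmonic_decomp h f g \<and> sense_preserving f g \<and>
     (\<exists>h'. homeomorphism unit_disc (h ` unit_disc) h h') \<and>
     (\<forall>z\<in>unit_disc. cmod (deriv g z / deriv f z) \<le> (K - 1) / (K + 1))"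

definition taylor_coeff :: "(complex \<Rightarrow> complex) \<Rightarrow> nat \<Rightarrow> complex" where
  "taylor_coeff f m = fps_nth (fps_expansion f 0) m"

definition hat :: "(complex \<Rightarrow> complex) \<Rightarrow> real \<Rightarrow> real" where
  "hat f r = r + (\<Sum>m. cmod (taylor_coeff f (m + 2)) * r ^ (m + 2))"

definition value_at_minus_one :: "(complex \<Rightarrow> complex) \<Rightarrow> complex" where
  "value_at_minus_one f = Lim (at_left (1::real)) (\<lambda>r. f (- of_real r))"

definition bohr_root :: "real \<Rightarrow> (complex \<Rightarrow> complex) \<Rightarrow> real \<Rightarrow> bool" where
  "bohr_root K f0 r \<longleftrightarrow>
     0 < r \<and> r < 1 \<and> of_real (2 * K / (K + 1) * hat f0 r) = - value_at_minus_one f0"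

(* The majorant series starts at m = 1, hence the shift of the summation index. *)
definition bohr_term :: "(complex \<Rightarrow> complex) \<Rightarrow> (complex \<Rightarrow> complex) \<Rightarrow> real \<Rightarrow> nat \<Rightarrow> real" where
  "bohr_term f g r m = (cmod (taylor_coeff f (Suc m)) + cmod (taylor_coeff g (Suc m))) * r ^ Suc m"

definition boundary_dist :: "(complex \<Rightarrow> complex) \<Rightarrow> real" where
  "boundary_dist f = infdist (f 0) (frontier (f ` unit_disc))"

end

theory Submission
  imports Defs
begin

text \<open>
  Since \<open>f1\<close> is normalised and \<open>h1 = h \<circ> w\<close>, Schwarz's lemma forces \<open>w = id\<close>, so that \<open>f1 = f\<close>
  and \<open>g1 = g\<close>. It remains to compare \<open>f\<close> with \<open>f0\<close>. As \<open>\<psi>\<close> is not assumed to be starlike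
  with respect to 1, the usual subordination \<open>f' \<prec> f0'\<close> is not available, and two
  other arguments replace it.

  For the covering radius, a minimum principle for \<open>Re p(z) - g(|z|)\<close> is used: at a
  critical point \<open>z p'(z)\<close> is real. Applied to \<open>p = log f'\<close> it gives \<open>|f'(z)| \<ge> f0'(-|z|)\<close>, because
  \<open>\<psi>\<close> is real only on the real axis and increases there; applied to \<open>f / (z f')\<close> and to \<open>log (f(z) / z)\<close>
  it gives \<open>|f(z)| \<ge> -f0(-|z|)\<close>, hence the distance to the boundary is at least \<open>-f0(-1)\<close>.

  For the majorant, \<open>\<psi>\<close> is typically real, so that its coefficients are at most \<open>n \<psi>'(0)\<close>, where
  \<open>\<psi>'(0) \<le> 2\<close>. If \<open>w(z) = c z + \<dots>\<close> is the Schwarz function of \<open>f\<close>, then \<open>f'(z) = f0'(c z) exp E(z)\<close> where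
  the majorant of \<open>E\<close> is \<open>O(1 - |c|)\<close>; for radii up to \<open>1/3\<close> this loss is compensated by
  the gain in passing from \<open>f0'(z)\<close> to \<open>f0'(c z)\<close>, once both are integrated.
  The co-analytic part is controlled by Bohr's inequality for \<open>g' / f'\<close>.
\<close>

section \<open>Coefficient estimates on the disc\<close>

text \<open>The majorant comparison rests on one balance. Passing from \<open>f0'(z)\<close> to
  \<open>f0'(c z)\<close> lowers the linear term of the majorant by
  \<open>(1 - |c|) \<psi>'(0) t\<close>, while \<open>exp E\<close> costs the same factor
  \<open>(1 - |c|) \<psi>'(0)\<close> times a quantity of order \<open>t\<^sup>2\<close>. Gain and
  loss thus scale alike, and a single numerical inequality in \<open>t\<close> serves every \<psi>
  and every \<open>f\<close>. For the derivatives that inequality breaks down before 1/3: the term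
  \<open>51 / 25 * P' - t\<close> of \<open>maj_deriv_compare\<close> is positive at
  \<open>t = 1/3\<close>. Its primitive, however, is still nonpositive on the whole of [0, 1/3].
  Hence the derivative estimates carry this signed error term along and the sign is only settled
  after integration from 0. The same 1/3 is also Bohr's radius, which enters twice: for
  \<open>w(z) / z\<close>, where it keeps the majorant of \<open>w\<close> at radius
  \<open>t\<close> below \<open>t\<close>, and for the dilatation.\<close>

lemma taylor_coeff_deriv: "taylor_coeff f n = (deriv ^^ n) f 0 / fact n"
  by (simp add: taylor_coeff_def fps_expansion_def)

lemma taylor_coeff_deriv_fun:
  "taylor_coeff (deriv f) n = of_nat (Suc n) * taylor_coeff f (Suc n)"
  by (simp add: taylor_coeff_deriv funpow_swap1 del: of_nat_Suc)

lemma taylor_coeff_0 [simp]: "taylor_coeff f 0 = f 0"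
  and taylor_coeff_1 [simp]: "taylor_coeff f (Suc 0) = deriv f 0"
  by (simp_all add: taylor_coeff_deriv)

text \<open>Cauchy's formula with the circle written out as a real integral, so that real parts,
  conjugates and pointwise bounds can be taken under the integral.\<close>

lemma circle_integral_coeff:
  assumes "f holomorphic_on ball 0 1" "0 < r" "r < 1"
  shows "((\<lambda>x. f (of_real r * cis (2 * pi * x)) * cis (- (2 * pi * real n * x))) has_integral
           taylor_coeff f n * of_real r ^ n) {0..1}"
proof -
  have sub: "cball 0 r \<subseteq> ball (0::complex) 1"
    using assms by auto
  have "((\<lambda>u. f u / (u - 0) ^ Suc n) has_contour_integral
      ((2 * pi * \<i>) / (fact n) * (deriv ^^ n) f 0)) (circlepath 0 r)"
  proof (rule Cauchy_has_contour_integral_higher_derivative_circlepath)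
    show "continuous_on (cball 0 r) f"
      using assms sub holomorphic_on_imp_continuous_on continuous_on_subset by blast
    show "f holomorphic_on ball 0 r"
      using assms sub by (meson ball_subset_cball holomorphic_on_subset subset_trans)
  qed (use assms in auto)
  then have I: "((\<lambda>x. f (circlepath 0 r x) / circlepath 0 r x ^ Suc n *
      vector_derivative (circlepath 0 r) (at x)) has_integral
      ((2 * pi * \<i>) / (fact n) * (deriv ^^ n) f 0)) {0..1}"
    by (simp add: has_contour_integral)
  have "((\<lambda>x. of_real r ^ n / (2 * pi * \<i>) * (f (circlepath 0 r x) / circlepath 0 r x ^ Suc n *
      vector_derivative (circlepath 0 r) (at x))) has_integral
      of_real r ^ n / (2 * pi * \<i>) * ((2 * pi * \<i>) / (fact n) * (deriv ^^ n) f 0)) {0..1}"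
    by (rule has_integral_mult_right[OF I])
  also have "of_real r ^ n / (2 * pi * \<i>) * ((2 * pi * \<i>) / (fact n) * (deriv ^^ n) f 0)
      = taylor_coeff f n * of_real r ^ n"
    using complex_i_not_zero pi_neq_zero by (simp add: taylor_coeff_deriv field_simps del: i_squared)
  also have "(\<lambda>x. of_real r ^ n / (2 * pi * \<i>) * (f (circlepath 0 r x) / circlepath 0 r x ^ Suc n *
      vector_derivative (circlepath 0 r) (at x)))
      = (\<lambda>x. f (of_real r * cis (2 * pi * x)) * cis (- (2 * pi * real n * x)))"
  proof
    fix x :: real
    have c: "circlepath 0 r x = of_real r * cis (2 * pi * x)"
      by (simp add: circlepath cis_conv_exp mult_ac)
    have v: "vector_derivative (circlepath 0 r) (at x) = 2 * pi * \<i> * (of_real r * cis (2 * pi * x))"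
      by (simp add: vector_derivative_circlepath cis_conv_exp mult_ac)
    have "cis (2 * pi * x) ^ n * cis (- (2 * pi * real n * x)) = 1"
      by (simp add: Complex.DeMoivre cis_mult mult_ac)
    then have *: "cis (- (2 * pi * real n * x)) = 1 / cis (2 * pi * x) ^ n"
      by (simp add: field_simps)
    show "of_real r ^ n / (2 * pi * \<i>) * (f (circlepath 0 r x) / circlepath 0 r x ^ Suc n *
      vector_derivative (circlepath 0 r) (at x))
      = f (of_real r * cis (2 * pi * x)) * cis (- (2 * pi * real n * x))"
      unfolding c v * using assms by (simp add: field_simps power_mult_distrib)
  qed
  finally show ?thesis .
qed

text \<open>The integral is, up to a power of \<open>r\<close>, the constant term of
  \<open>f z * z ^ n\<close>. Combined with the previous lemma it turns \<open>f\<close> into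
  \<open>2 Re f\<close> or \<open>2 Im f\<close> under the integral, where sign hypotheses
  apply.\<close>

lemma circle_integral_conj_coeff:
  assumes "f holomorphic_on ball 0 1" "0 < r" "r < 1" "n > 0"
  shows "((\<lambda>x. f (of_real r * cis (2 * pi * x)) * cis (2 * pi * real n * x)) has_integral 0) {0..1}"
proof -
  have "(\<lambda>z. f z * z ^ n) holomorphic_on ball 0 1"
    using assms by (intro holomorphic_intros)
  from circle_integral_coeff[OF this assms(2,3), of 0] assms
  have "((\<lambda>x. f (of_real r * cis (2 * pi * x)) * (of_real r * cis (2 * pi * x)) ^ n) has_integral 0) {0..1}"
    by (simp add: power_0_left)
  from has_integral_mult_right[OF this, of "1 / of_real r ^ n"] show ?thesis
    using assms by (simp add: power_mult_distrib Complex.DeMoivre mult_ac)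
qed

lemma le_of_power_bound:
  fixes A B :: real
  assumes "\<And>r. 0 < r \<Longrightarrow> r < 1 \<Longrightarrow> A * r ^ n \<le> B"
  shows "A \<le> B"
proof (rule tendsto_upperbound)
  show "((\<lambda>r. A * r ^ n) \<longlongrightarrow> A) (at_left 1)"
    by (auto intro!: tendsto_eq_intros)
  show "\<forall>\<^sub>F r in at_left 1. A * r ^ n \<le> B"
    using eventually_at_left[of 0 "1::real"] assms by (auto intro: exI[of _ 0])
qed auto

text \<open>\<open>taylor_coeff p n * r ^ n\<close> is the n-th Fourier coefficient of the
  nonnegative function \<open>2 Re p\<close> on the circle, hence bounded by its mean value; then
  \<open>r\<close> tends to 1.\<close>

lemma caratheodory_coeff:
  assumes holo: "p holomorphic_on ball 0 1" and pos: "\<And>z. z \<in> ball 0 1 \<Longrightarrow> 0 \<le> Re (p z)"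
    and "n > 0"
  shows "cmod (taylor_coeff p n) \<le> 2 * Re (p 0)"
proof (rule le_of_power_bound[where n = n])
  fix r :: real assume r: "0 < r" "r < 1"
  let ?c = "\<lambda>x. of_real r * cis (2 * pi * x)"
  have "((\<lambda>x. p (?c x) * cis (- (2 * pi * real n * x)) + cnj (p (?c x) * cis (2 * pi * real n * x)))
      has_integral taylor_coeff p n * of_real r ^ n + cnj 0) {0..1}"
    by (intro has_integral_add circle_integral_coeff has_integral_cnj[unfolded o_def, THEN iffD2] circle_integral_conj_coeff)
       (use holo r \<open>n > 0\<close> in auto)
  also have "(\<lambda>x. p (?c x) * cis (- (2 * pi * real n * x)) + cnj (p (?c x) * cis (2 * pi * real n * x)))
     = (\<lambda>x. of_real (2 * Re (p (?c x))) * cis (- (2 * pi * real n * x)))"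
    by (simp add: fun_eq_iff complex_add_cnj cis_cnj flip: distrib_right)
  finally have I: "((\<lambda>x. of_real (2 * Re (p (?c x))) * cis (- (2 * pi * real n * x)))
      has_integral taylor_coeff p n * of_real r ^ n) {0..1}"
    by simp
  have J: "((\<lambda>x. 2 * Re (p (?c x))) has_integral 2 * Re (p 0)) {0..1}"
    using has_integral_mult_right[OF has_integral_Re[OF circle_integral_coeff[OF holo r, of 0]], of 2]
    by simp
  have "cmod (taylor_coeff p n * of_real r ^ n) \<le> 2 * Re (p 0)"
  proof -
    have "norm (integral {0..1} (\<lambda>x. of_real (2 * Re (p (?c x))) * cis (- (2 * pi * real n * x))))
       \<le> integral {0..1} (\<lambda>x. 2 * Re (p (?c x)))"
    proof (rule integral_norm_bound_integral)
      fix x :: real assume "x \<in> {0..1}"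
      have "?c x \<in> ball 0 1" using r by (simp add: norm_mult)
      then show "norm (of_real (2 * Re (p (?c x))) * cis (- (2 * pi * real n * x))) \<le> 2 * Re (p (?c x))"
        using pos[of "?c x"] by (simp add: norm_mult)
    qed (use I J in \<open>auto simp: has_integral_iff\<close>)
    then show ?thesis using I J by (simp add: has_integral_iff)
  qed
  then show "cmod (taylor_coeff p n) * r ^ n \<le> 2 * Re (p 0)"
    using r by (simp add: norm_mult norm_power)
qed

text \<open>Caratheodory's bound for \<open>k - u f\<close>, where the unimodular \<open>u\<close>
  rotates \<open>f 0\<close> onto its modulus. The form linear in \<open>k - |f 0|\<close> is the
  source of Bohr's radius 1/3 and of the factor \<open>1 - a\<close> in the estimate of the Schwarz
  function.\<close>

lemma bounded_coeff:
  assumes holo: "f holomorphic_on ball 0 1" and bd: "\<And>z. z \<in> ball 0 1 \<Longrightarrow> cmod (f z) \<le> k"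
    and "n > 0"
  shows "cmod (taylor_coeff f n) \<le> 2 * (k - cmod (f 0))"
proof -
  obtain u where u: "cmod u = 1" "u * f 0 = of_real (cmod (f 0))"
  proof (cases "f 0 = 0")
    case False
    then show ?thesis
      by (intro that[of "cnj (sgn (f 0))"])
         (auto simp: norm_sgn norm_divide sgn_eq complex_norm_square[symmetric] power2_eq_square mult.commute[of "cnj _"])
  qed (use that[of 1] in auto)
  define p where "p = (\<lambda>z. of_real k - u * f z)"
  have "f has_fps_expansion fps_expansion f 0" "p has_fps_expansion fps_expansion p 0"
    using holo by (auto intro!: has_fps_expansion_fps_expansion[of "ball 0 1"] holomorphic_intros simp: p_def)
  moreover have "p has_fps_expansion fps_const (of_real k) - fps_const u * fps_expansion f 0"
    unfolding p_def using calculation by (intro fps_expansion_intros)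
  ultimately have "fps_expansion p 0 = fps_const (of_real k) - fps_const u * fps_expansion f 0"
    using fps_expansion_eqI by blast
  then have "taylor_coeff p n = - u * taylor_coeff f n"
    using \<open>n > 0\<close> by (simp add: taylor_coeff_def)
  moreover have "cmod (taylor_coeff p n) \<le> 2 * Re (p 0)"
  proof (rule caratheodory_coeff)
    show "p holomorphic_on ball 0 1" using holo by (auto simp: p_def intro!: holomorphic_intros)
    fix z :: complex assume "z \<in> ball 0 1"
    then have "Re (u * f z) \<le> k"
      using bd[of z] complex_Re_le_cmod[of "u * f z"] u(1) by (simp add: norm_mult)
    then show "0 \<le> Re (p z)" by (simp add: p_def)
  qed fact
  ultimately show ?thesis
    using u by (simp add: norm_mult p_def)
qed

lemma abs_sin_mult_le: "\<bar>sin (real n * x)\<bar> \<le> real n * \<bar>sin x\<bar>"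
proof (induction n)
  case (Suc n)
  have "\<bar>sin (real (Suc n) * x)\<bar> = \<bar>sin (real n * x) * cos x + cos (real n * x) * sin x\<bar>"
    by (simp add: sin_add algebra_simps)
  also have "\<dots> \<le> \<bar>sin (real n * x)\<bar> * \<bar>cos x\<bar> + \<bar>cos (real n * x)\<bar> * \<bar>sin x\<bar>"
    by (metis abs_mult abs_triangle_ineq)
  also have "\<dots> \<le> \<bar>sin (real n * x)\<bar> * 1 + 1 * \<bar>sin x\<bar>"
    by (intro add_mono mult_mono) auto
  finally show ?case using Suc by (simp add: algebra_simps)
qed simp

text \<open>Rogosinski's bound: \<open>Im f\<close> times the sine is nonnegative on the circle, and
  \<open>|sin (n x)|\<close> is at most \<open>n |sin x|\<close>, so the n-th sine coefficient of
  \<open>Im f\<close> is at most \<open>n\<close> times the first one.\<close>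

lemma typically_real_coeff:
  assumes holo: "f holomorphic_on ball 0 1"
    and sgn: "\<And>z. z \<in> ball 0 1 \<Longrightarrow> 0 \<le> Im (f z) * Im z"
    and "n > 0"
  shows "\<bar>Re (taylor_coeff f n)\<bar> \<le> real n * Re (deriv f 0)"
proof (rule le_of_power_bound[where n = n])
  fix r :: real assume r: "0 < r" "r < 1"
  let ?c = "\<lambda>x. of_real r * cis (2 * pi * x)"
  have I: "((\<lambda>x. 2 * (Im (f (?c x)) * sin (2 * pi * real m * x))) has_integral
       Re (taylor_coeff f m) * r ^ m) {0..1}" if "m > 0" for m
  proof -
    have "((\<lambda>x. Re (f (?c x) * cis (- (2 * pi * real m * x)) - f (?c x) * cis (2 * pi * real m * x)))
        has_integral Re (taylor_coeff f m * of_real r ^ m - 0)) {0..1}"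
      by (intro has_integral_Re has_integral_diff circle_integral_coeff circle_integral_conj_coeff)
         (use holo r that in auto)
    then show ?thesis
      by (simp add: algebra_simps flip: of_real_power)
  qed
  have "r * (real n * Re (deriv f 0)) - \<bar>Re (taylor_coeff f n)\<bar> * r ^ n \<ge> 0"
  proof -
    have "norm (integral {0..1} (\<lambda>x. 2 * (Im (f (?c x)) * sin (2 * pi * real n * x))))
       \<le> integral {0..1} (\<lambda>x. real n * (2 * (Im (f (?c x)) * sin (2 * pi * real 1 * x))))"
    proof (rule integral_norm_bound_integral)
      fix x :: real assume "x \<in> {0..1}"
      have "?c x \<in> ball 0 1" using r by (simp add: norm_mult)
      from sgn[OF this] have "0 \<le> Im (f (?c x)) * sin (2 * pi * x)"
        using r by (auto simp: zero_le_mult_iff mult_le_0_iff)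
      then have *: "Im (f (?c x)) * sin (2 * pi * x) = \<bar>Im (f (?c x))\<bar> * \<bar>sin (2 * pi * x)\<bar>"
        by (simp add: abs_mult flip: abs_mult)
      have "\<bar>Im (f (?c x))\<bar> * \<bar>sin (real n * (2 * pi * x))\<bar> \<le> \<bar>Im (f (?c x))\<bar> * (real n * \<bar>sin (2 * pi * x)\<bar>)"
        by (intro mult_left_mono abs_sin_mult_le) auto
      then show "norm (2 * (Im (f (?c x)) * sin (2 * pi * real n * x)))
         \<le> real n * (2 * (Im (f (?c x)) * sin (2 * pi * real 1 * x)))"
        using * by (simp add: abs_mult mult_ac)
    next
      show "(\<lambda>x. real n * (2 * (Im (f (?c x)) * sin (2 * pi * real 1 * x)))) integrable_on {0..1}"
        using has_integral_mult_right[OF I[of 1], of "real n"] by (auto simp: has_integral_iff)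
    qed (use I[OF \<open>n > 0\<close>] in \<open>auto simp: has_integral_iff\<close>)
    moreover have "integral {0..1} (\<lambda>x. real n * (2 * (Im (f (?c x)) * sin (2 * pi * real 1 * x))))
        = real n * (Re (deriv f 0) * r)"
      using has_integral_mult_right[OF I[of 1], of "real n"] by (simp add: has_integral_iff)
    moreover have "integral {0..1} (\<lambda>x. 2 * (Im (f (?c x)) * sin (2 * pi * real n * x)))
        = Re (taylor_coeff f n) * r ^ n"
      using I[OF \<open>n > 0\<close>] by (rule integral_unique)
    ultimately have "norm (Re (taylor_coeff f n) * r ^ n) \<le> real n * (Re (deriv f 0) * r)"
      by (simp only:)
    then show ?thesis
      using r by (simp add: abs_mult mult_ac)
  qed
  moreover have "0 \<le> Re (deriv f 0)"
  proof -
    have "0 \<le> Re (taylor_coeff f 1) * r ^ 1"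
    proof (rule has_integral_nonneg[OF I])
      fix x :: real
      have "?c x \<in> ball 0 1" using r by (simp add: norm_mult)
      from sgn[OF this] show "0 \<le> 2 * (Im (f (?c x)) * sin (2 * pi * real 1 * x))"
        using r by (auto simp: zero_le_mult_iff mult_le_0_iff)
    qed simp
    then show ?thesis using r by (simp add: zero_le_mult_iff)
  qed
  then have "r * (real n * Re (deriv f 0)) \<le> 1 * (real n * Re (deriv f 0))"
    using r by (intro mult_right_mono) auto
  ultimately show "\<bar>Re (taylor_coeff f n)\<bar> * r ^ n \<le> real n * Re (deriv f 0)"
    by linarith
qed

section \<open>Minimum principle and starlikeness\<close>

lemma Re_curve_derivative:
  assumes "(c has_vector_derivative c') (at x)" "(p has_field_derivative d) (at (c x))"
  shows "((\<lambda>s. Re (p (c s))) has_real_derivative Re (c' * d)) (at x)"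
proof -
  have "((p \<circ> c) has_vector_derivative c' * d) (at x)"
    using assms by (rule field_vector_diff_chain_at)
  from bounded_linear.has_vector_derivative[OF bounded_linear_Re this] show ?thesis
    by (simp add: has_real_derivative_iff_has_vector_derivative o_def)
qed

text \<open>Take a minimum of \<open>Re p(z) - g(|z|)\<close> over the closed disc through
  \<open>z\<close>. The angular derivative vanishes there, so \<open>crit\<close> applies and the
  radial derivative is positive; a small inward step would then lower the value. Only inward steps
  are taken, so the minimum may lie on the bounding circle.\<close>

lemma disc_minimum_principle_strict:
  fixes p :: "complex \<Rightarrow> complex" and g g' :: "real \<Rightarrow> real"
  assumes holo: "p holomorphic_on ball 0 1"
    and cont: "continuous_on {0..<1} g"
    and der: "\<And>r. 0 < r \<Longrightarrow> r < 1 \<Longrightarrow> (g has_real_derivative g' r) (at r)"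
    and zero: "g 0 < Re (p 0)"
    and crit: "\<And>z. z \<in> ball 0 1 \<Longrightarrow> z \<noteq> 0 \<Longrightarrow> Re (p z) \<le> g (cmod z) \<Longrightarrow> Im (z * deriv p z) = 0
                 \<Longrightarrow> cmod z * g' (cmod z) < Re (z * deriv p z)"
    and z: "z \<in> ball 0 1"
  shows "g (cmod z) < Re (p z)"
proof (rule ccontr)
  assume neg: "\<not> g (cmod z) < Re (p z)"
  define G where "G = (\<lambda>z. Re (p z) - g (cmod z))"
  have sub: "cball 0 (cmod z) \<subseteq> ball (0::complex) 1" using z by auto
  have "continuous_on (cball 0 (cmod z)) p"
    using holo sub holomorphic_on_imp_continuous_on continuous_on_subset by blast
  moreover have "continuous_on (cball 0 (cmod z)) (\<lambda>z. g (cmod z))"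
    by (rule continuous_on_compose2[OF cont]) (use z in \<open>auto intro!: continuous_intros\<close>)
  ultimately have "continuous_on (cball 0 (cmod z)) G"
    unfolding G_def by (intro continuous_intros)
  then obtain z1 where z1: "z1 \<in> cball 0 (cmod z)" "\<And>y. y \<in> cball 0 (cmod z) \<Longrightarrow> G z1 \<le> G y"
    using continuous_attains_inf[of "cball (0::complex) (cmod z)" G] by auto
  have "G z1 \<le> 0" using z1(2)[of z] neg by (simp add: G_def)
  then have [simp]: "z1 \<noteq> 0" using zero by (auto simp: G_def)
  have z1b: "z1 \<in> ball 0 1" using z1(1) sub by blast
  have dp: "(p has_field_derivative deriv p z1) (at z1)"
    using holo z1b by (simp add: holomorphic_derivI)
  have "((\<lambda>t. z1 * cis t) has_vector_derivative z1 * \<i>) (at 0)"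
    unfolding cis_conv_exp
    by (auto intro!: derivative_eq_intros has_vector_derivative_real_field simp: has_vector_derivative_real_field)
  from Re_curve_derivative[OF this, of p "deriv p z1"]
  have "((\<lambda>t. Re (p (z1 * cis t))) has_real_derivative Re (z1 * \<i> * deriv p z1)) (at 0)"
    using dp by simp
  then have "Re (z1 * \<i> * deriv p z1) = 0"
  proof (rule DERIV_local_min[where d = 1])
    show "\<forall>y. \<bar>0 - y\<bar> < 1 \<longrightarrow> Re (p (z1 * cis 0)) \<le> Re (p (z1 * cis y))"
    proof (intro allI impI)
      fix y :: real
      have "G z1 \<le> G (z1 * cis y)" using z1(1) by (intro z1(2)) (simp add: norm_mult)
      then show "Re (p (z1 * cis 0)) \<le> Re (p (z1 * cis y))"
        by (simp add: G_def norm_mult)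
    qed
  qed simp
  then have "Im (z1 * deriv p z1) = 0" by (simp add: algebra_simps)
  with \<open>G z1 \<le> 0\<close> have *: "cmod z1 * g' (cmod z1) < Re (z1 * deriv p z1)"
    by (intro crit z1b) (auto simp: G_def)
  have "((\<lambda>s. of_real s * z1) has_vector_derivative z1) (at 1)"
    by (auto intro!: derivative_eq_intros)
  from Re_curve_derivative[OF this, of p "deriv p z1"]
  have d1: "((\<lambda>s. Re (p (of_real s * z1))) has_real_derivative Re (z1 * deriv p z1)) (at 1)"
    using dp by simp
  have "(g has_real_derivative g' (cmod z1)) (at (1 * cmod z1))"
    using der[of "cmod z1"] z1b by simp
  then have d2: "((\<lambda>s. g (s * cmod z1)) has_real_derivative g' (cmod z1) * cmod z1) (at 1)"
    by (rule DERIV_chain2) (auto intro!: derivative_eq_intros)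
  obtain d where d: "d > 0" "\<And>h. 0 < h \<Longrightarrow> h < d \<Longrightarrow>
     Re (p (of_real (1 - h) * z1)) - g ((1 - h) * cmod z1) < Re (p (of_real 1 * z1)) - g (1 * cmod z1)"
    using DERIV_pos_inc_left[OF DERIV_diff[OF d1 d2]] * by (auto simp: mult.commute)
  define h where "h = min (d / 2) (1 / 2)"
  have h: "0 < h" "h < d" "h < 1" using d(1) by (auto simp: h_def)
  have n: "cmod (of_real (1 - h) * z1) = (1 - h) * cmod z1"
    using h by (simp add: norm_mult del: of_real_diff)
  have "(1 - h) * cmod z1 \<le> 1 * cmod z1" using h by (intro mult_right_mono) auto
  then have "G z1 \<le> G (of_real (1 - h) * z1)"
    using z1(1) unfolding mem_cball_0 by (intro z1(2)) (unfold mem_cball_0 n, linarith)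
  with d(2)[OF h(1,2)] show False
    unfolding G_def n by simp
qed

text \<open>Perturbing \<open>g\<close> to \<open>g r - e' * (1 + r)\<close> makes both inequalities
  strict: the constant does so at 0, the linear term for the radial derivative.\<close>

lemma disc_minimum_principle:
  fixes p :: "complex \<Rightarrow> complex" and g g' :: "real \<Rightarrow> real"
  assumes holo: "p holomorphic_on ball 0 1"
    and cont: "continuous_on {0..<1} g"
    and der: "\<And>r. 0 < r \<Longrightarrow> r < 1 \<Longrightarrow> (g has_real_derivative g' r) (at r)"
    and zero: "g 0 \<le> Re (p 0)"
    and crit: "\<And>z. z \<in> ball 0 1 \<Longrightarrow> z \<noteq> 0 \<Longrightarrow> Re (p z) < g (cmod z) \<Longrightarrow> Im (z * deriv p z) = 0
                 \<Longrightarrow> cmod z * g' (cmod z) \<le> Re (z * deriv p z)"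
    and z: "z \<in> ball 0 1"
  shows "g (cmod z) \<le> Re (p z)"
proof (rule field_le_epsilon)
  fix e :: real assume "e > 0"
  define e' where "e' = e / 2"
  have e': "e' > 0" using \<open>e > 0\<close> by (simp add: e'_def)
  have "g (cmod z) - e' * (1 + cmod z) < Re (p z)"
  proof (rule disc_minimum_principle_strict[where p = p and z = z
        and g = "\<lambda>r. g r - e' * (1 + r)" and g' = "\<lambda>r. g' r - e'"])
    show "continuous_on {0..<1} (\<lambda>r. g r - e' * (1 + r))"
      by (intro continuous_intros cont)
    show "((\<lambda>r. g r - e' * (1 + r)) has_real_derivative g' r - e') (at r)" if "0 < r" "r < 1" for r
      using der[OF that] by (auto intro!: derivative_eq_intros)
    fix z :: complex
    assume *: "z \<in> ball 0 1" "z \<noteq> 0" "Re (p z) \<le> g (cmod z) - e' * (1 + cmod z)"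
      "Im (z * deriv p z) = 0"
    have "0 < e' * (1 + cmod z)" using e' by (simp add: add_pos_nonneg)
    with * have "cmod z * g' (cmod z) \<le> Re (z * deriv p z)" by (intro crit) auto
    moreover have "0 < cmod z * e'" using * e' by simp
    ultimately show "cmod z * (g' (cmod z) - e') < Re (z * deriv p z)"
      by (simp only: right_diff_distrib)
  qed (use holo z zero e' in auto)
  moreover have "e' * (1 + cmod z) \<le> e' * 2" using z e' by (intro mult_left_mono) auto
  ultimately show "g (cmod z) \<le> Re (p z) + e" by (simp add: e'_def)
qed

text \<open>The Noshiro-Warschawski criterion: along the segment from \<open>a\<close> to
  \<open>b\<close> the real part of \<open>F / (b - a)\<close> has derivative
  \<open>Re F'\<close>.\<close>

lemma positive_derivative_inj_on:
  assumes "convex S" and der: "\<And>z. z \<in> S \<Longrightarrow> (F has_field_derivative F' z) (at z)"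
    and pos: "\<And>z. z \<in> S \<Longrightarrow> 0 < Re (F' z)"
  shows "inj_on F S"
proof (rule inj_onI, rule ccontr)
  fix a b assume ab: "a \<in> S" "b \<in> S" "F a = F b" "a \<noteq> b"
  define c where "c s = a + of_real s * (b - a)" for s :: real
  have cS: "c s \<in> S" if "0 \<le> s" "s \<le> 1" for s
    using convexD_alt[OF \<open>convex S\<close> ab(1,2) that]
    by (simp add: c_def algebra_simps scaleR_conv_of_real)
  have "Re (F (c 0) / (b - a)) < Re (F (c 1) / (b - a))"
  proof (rule DERIV_pos_imp_increasing[where f = "\<lambda>s. Re (F (c s) / (b - a))"])
    fix s :: real assume s: "0 \<le> s" "s \<le> 1"
    have "(c has_vector_derivative (b - a)) (at s)"
      unfolding c_def by (auto intro!: derivative_eq_intros)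
    moreover have "((\<lambda>z. F z / (b - a)) has_field_derivative F' (c s) / (b - a)) (at (c s))"
      by (intro DERIV_cdivide der cS s)
    ultimately have "((\<lambda>s. Re (F (c s) / (b - a))) has_real_derivative
        Re ((b - a) * (F' (c s) / (b - a)))) (at s)"
      by (rule Re_curve_derivative)
    then show "\<exists>y. ((\<lambda>s. Re (F (c s) / (b - a))) has_real_derivative y) (at s) \<and> 0 < y"
      using pos[OF cS[OF s]] ab(4) by auto
  qed simp
  moreover have "c 0 = a" "c 1 = b" by (simp_all add: c_def)
  ultimately show False using ab(3) by simp
qed

lemma holomorphic_log_on_disc:
  assumes "q holomorphic_on ball 0 1" "\<And>z. z \<in> ball 0 1 \<Longrightarrow> q z \<noteq> 0" "q 0 = 1"
  obtains l where "l holomorphic_on ball 0 1" "l 0 = 0" "\<And>z. z \<in> ball 0 1 \<Longrightarrow> exp (l z) = q z"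
    "\<And>z. z \<in> ball 0 1 \<Longrightarrow> deriv l z = deriv q z / q z"
proof -
  obtain h where h: "h holomorphic_on ball 0 1" "\<And>z. z \<in> ball 0 1 \<Longrightarrow> exp (h z) = q z"
    using holomorphic_logarithm_exists[of "ball (0::complex) 1" q 0] assms by auto
  define l where "l z = h z - h 0" for z
  have l: "l holomorphic_on ball 0 1" unfolding l_def using h by (intro holomorphic_intros)
  have e: "exp (l z) = q z" if "z \<in> ball 0 1" for z
    using h(2)[OF that] h(2)[of 0] assms(3) by (simp add: l_def exp_diff)
  have "deriv l z = deriv q z / q z" if "z \<in> ball 0 1" for z
  proof -
    have "((\<lambda>z. exp (l z)) has_field_derivative exp (l z) * deriv l z) (at z)"
      using holomorphic_derivI[OF l open_ball that] by (auto intro!: derivative_eq_intros)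
    then have "(q has_field_derivative exp (l z) * deriv l z) (at z)"
      by (rule DERIV_cong_ev[OF refl _ refl, THEN iffD1, rotated])
         (use eventually_nhds_in_open[OF open_ball that] e in \<open>auto elim!: eventually_mono\<close>)
    then show ?thesis using e[OF that] assms(2)[OF that] by (simp add: DERIV_imp_deriv)
  qed
  then show ?thesis using that[of l] l e by (auto simp: l_def)
qed

lemma deriv_factor:
  assumes "q holomorphic_on ball 0 1" "\<And>z. z \<in> ball 0 1 \<Longrightarrow> f z = z * q z" "z \<in> ball 0 1"
  shows "deriv f z = q z + z * deriv q z"
proof -
  have "((\<lambda>z. z * q z) has_field_derivative q z + z * deriv q z) (at z)"
    using holomorphic_derivI[OF assms(1) open_ball assms(3)] by (auto intro!: derivative_eq_intros)
  then have "(f has_field_derivative q z + z * deriv q z) (at z)"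
    by (rule DERIV_cong_ev[OF refl _ refl, THEN iffD1, rotated])
       (use eventually_nhds_in_open[OF open_ball assms(3)] assms(2) in \<open>auto elim!: eventually_mono\<close>)
  then show ?thesis by (rule DERIV_imp_deriv)
qed

text \<open>With \<open>s = f / (z f')\<close> one has \<open>z s' = 1 - s (1 + z f'' / f')\<close>, so at a critical point of
  \<open>Re s\<close> on a circle where \<open>Re s \<le> 0\<close> the radial derivative would be at least 1.\<close>

lemma convex_imp_starlike:
  assumes f: "classA f" and nz: "\<And>z. z \<in> ball 0 1 \<Longrightarrow> deriv f z \<noteq> 0"
    and pos: "\<And>z. z \<in> ball 0 1 \<Longrightarrow> 0 < Re (convexity_quotient f z)"
  obtains q where "q holomorphic_on ball 0 1" "q 0 = 1" "\<And>z. z \<in> ball 0 1 \<Longrightarrow> f z = z * q z"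
    "\<And>z. z \<in> ball 0 1 \<Longrightarrow> q z \<noteq> 0" "\<And>z. z \<in> ball 0 1 \<Longrightarrow> 0 < Re (deriv f z / q z)"
proof -
  have holf: "f holomorphic_on ball 0 1" and f0: "f 0 = 0" "deriv f 0 = 1"
    using f by (auto simp: classA_def)
  obtain q where q: "q holomorphic_on ball 0 1" "\<And>z. z \<in> ball 0 1 \<Longrightarrow> f z = z * q z" "deriv f 0 = q 0"
    using Schwarz3[OF holf f0(1)] by auto
  have hol': "deriv f holomorphic_on ball 0 1" using holf by (intro holomorphic_deriv) auto
  define s where "s = (\<lambda>z. q z / deriv f z)"
  have hols: "s holomorphic_on ball 0 1"
    unfolding s_def by (rule holomorphic_on_divide[OF q(1) hol' nz])
  have ds: "z * deriv s z = 1 - s z * convexity_quotient f z" if z: "z \<in> ball 0 1" for z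
  proof -
    have "(s has_field_derivative (deriv q z * deriv f z - q z * deriv (deriv f) z) / (deriv f z * deriv f z)) (at z)"
      unfolding s_def
      by (rule DERIV_divide[OF holomorphic_derivI[OF q(1) open_ball z]
            holomorphic_derivI[OF hol' open_ball z] nz[OF z]])
    then have ds: "deriv s z = (deriv q z * deriv f z - q z * deriv (deriv f) z) / (deriv f z * deriv f z)"
      by (rule DERIV_imp_deriv)
    have "deriv f z = q z + z * deriv q z" by (rule deriv_factor[OF q(1,2) z])
    then have zq: "z * deriv q z = deriv f z - q z" by simp
    have "z * (deriv q z * deriv f z - q z * deriv (deriv f) z)
       = (z * deriv q z) * deriv f z - q z * (z * deriv (deriv f) z)"
      by (simp only: right_diff_distrib mult_ac)
    also have "\<dots> = deriv f z * deriv f z - q z * (deriv f z + z * deriv (deriv f) z)"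
      unfolding zq by (simp add: left_diff_distrib distrib_left)
    finally have eq: "z * (deriv q z * deriv f z - q z * deriv (deriv f) z) = \<dots>" .
    have "z * deriv s z = z * (deriv q z * deriv f z - q z * deriv (deriv f) z) / (deriv f z * deriv f z)"
      unfolding ds by simp
    also have "\<dots> = (deriv f z * deriv f z - q z * (deriv f z + z * deriv (deriv f) z)) / (deriv f z * deriv f z)"
      unfolding eq ..
    also have "\<dots> = 1 - s z * convexity_quotient f z"
      unfolding s_def convexity_quotient_def using nz[OF z] by (simp add: divide_simps)
    finally show ?thesis .
  qed
  have spos: "0 < Re (s z)" if "z \<in> ball 0 1" for z
  proof -
    have "(\<lambda>_. 0) (cmod z) < Re (s z)"
    proof (rule disc_minimum_principle_strict[where p = s and g = "\<lambda>_. 0" and g' = "\<lambda>_. 0"])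
      show "0 < Re (s 0)" using q(3) f0 by (simp add: s_def)
      fix z :: complex assume z: "z \<in> ball 0 1" "Re (s z) \<le> 0" "Im (z * deriv s z) = 0"
      define P where "P = convexity_quotient f z"
      have P: "0 < Re P" using pos[OF z(1)] by (simp add: P_def)
      have "Im (s z * P) = 0" using z(3) by (simp add: ds[OF z(1)] P_def)
      then have *: "Im (s z) * Re P = - (Re (s z) * Im P)" by simp
      \<comment> \<open>Since \<open>s P\<close> is real, eliminating \<open>Im s\<close> gives
        \<open>Re (s P) Re P = Re s |P|^2\<close>, which has the sign of
        \<open>Re s\<close>.\<close>
      have "Re (s z * P) * Re P = Re (s z) * (Re P)\<^sup>2 - (Im (s z) * Re P) * Im P"
        by (simp add: algebra_simps power2_eq_square)
      also have "\<dots> = Re (s z) * ((Re P)\<^sup>2 + (Im P)\<^sup>2)"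
        unfolding * by (simp add: algebra_simps power2_eq_square)
      also have "\<dots> \<le> 0"
        using z(2) by (simp add: mult_le_0_iff)
      finally have "Re (s z * P) \<le> 0" using P by (simp add: mult_le_0_iff)
      then show "cmod z * 0 < Re (z * deriv s z)"
        by (simp add: ds[OF z(1)] P_def[symmetric] del: times_complex.sel)
    qed (use that hols in auto)
    then show ?thesis by simp
  qed
  show ?thesis
  proof (rule that[OF q(1) _ q(2)])
    show "q 0 = 1" using q(3) f0 by simp
    fix z :: complex assume z: "z \<in> ball 0 1"
    show "q z \<noteq> 0" using spos[OF z] by (auto simp: s_def)
    have "deriv f z / q z = inverse (s z)" by (simp add: s_def)
    then show "0 < Re (deriv f z / q z)"
      using spos[OF z] by (simp add: add_pos_nonneg divide_pos_pos)
  qed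
qed

text \<open>In logarithmic coordinates \<open>\<zeta> \<mapsto> log f(exp \<zeta>)\<close> has derivative \<open>z f' / f\<close> on the
  (convex) left half-plane.\<close>

lemma starlike_inj_on:
  assumes q: "q holomorphic_on ball 0 1" "q 0 = 1" "\<And>z. z \<in> ball 0 1 \<Longrightarrow> f z = z * q z"
    "\<And>z. z \<in> ball 0 1 \<Longrightarrow> q z \<noteq> 0" and pos: "\<And>z. z \<in> ball 0 1 \<Longrightarrow> 0 < Re (deriv f z / q z)"
  shows "inj_on f (ball 0 1)"
proof (rule inj_onI)
  obtain l where l: "l holomorphic_on ball 0 1" "\<And>z. z \<in> ball 0 1 \<Longrightarrow> exp (l z) = q z"
    "\<And>z. z \<in> ball 0 1 \<Longrightarrow> deriv l z = deriv q z / q z"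
    using holomorphic_log_on_disc[OF q(1,4,2)] by metis
  define F where "F \<zeta> = \<zeta> + l (exp \<zeta>)" for \<zeta>
  define H where "H = {\<zeta>. Re \<zeta> < 0}"
  have eH: "exp \<zeta> \<in> ball 0 1" if "\<zeta> \<in> H" for \<zeta> using that by (simp add: H_def)
  have inj: "inj_on F H"
  proof (rule positive_derivative_inj_on)
    show "convex H" unfolding H_def by (rule convex_halfspace_Re_lt)
    fix \<zeta> assume \<zeta>: "\<zeta> \<in> H"
    have "((\<lambda>\<zeta>. l (exp \<zeta>)) has_field_derivative deriv l (exp \<zeta>) * exp \<zeta>) (at \<zeta>)"
      by (rule DERIV_chain2[OF holomorphic_derivI[OF l(1) open_ball eH[OF \<zeta>]] DERIV_exp])
    then show "(F has_field_derivative 1 + deriv l (exp \<zeta>) * exp \<zeta>) (at \<zeta>)"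
      unfolding F_def by (intro DERIV_add DERIV_ident)
    have "1 + deriv l (exp \<zeta>) * exp \<zeta> = deriv f (exp \<zeta>) / q (exp \<zeta>)"
      using deriv_factor[OF q(1,3) eH[OF \<zeta>]] l(3)[OF eH[OF \<zeta>]] q(4)[OF eH[OF \<zeta>]]
      by (simp add: field_simps)
    then show "0 < Re (1 + deriv l (exp \<zeta>) * exp \<zeta>)" using pos[OF eH[OF \<zeta>]] by simp
  qed
  fix a b assume ab: "a \<in> ball 0 1" "b \<in> ball 0 1" "f a = f b"
  show "a = b"
  proof (cases "a = 0 \<or> b = 0")
    case True
    then show ?thesis using ab q(3)[OF ab(1)] q(3)[OF ab(2)] q(4)[OF ab(1)] q(4)[OF ab(2)] by auto
  next
    case False
    have lnH: "Ln x \<in> H" if "x \<in> ball 0 1" "x \<noteq> 0" for x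
      using that by (simp add: H_def ln_less_zero)
    have eF: "exp (F (Ln x)) = f x" if "x \<in> ball 0 1" "x \<noteq> 0" for x
      using that l(2)[of x] q(3)[of x] by (simp add: F_def exp_add)
    have "exp (F (Ln a)) = exp (F (Ln b))" using False ab eF by simp
    then obtain n :: int where n: "F (Ln a) = F (Ln b) + of_int (2 * n) * pi * \<i>"
      unfolding exp_eq by auto
    \<comment> \<open>A shift by full periods stays in the half-plane and leaves \<open>exp\<close>
      unchanged, so injectivity of \<open>F\<close> absorbs the ambiguity of the logarithm.\<close>
    define c where "c = Ln b + of_int (2 * n) * pi * \<i>"
    have ec: "exp c = exp (Ln b)" unfolding c_def exp_eq by auto
    have "c \<in> H" using lnH[of b] ab False by (simp add: c_def H_def)
    have "F c = F (Ln a)" using n unfolding F_def ec by (simp add: c_def)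
    with inj \<open>c \<in> H\<close> lnH[of a] ab False have "c = Ln a" by (auto dest: inj_onD)
    then show ?thesis using ec False by simp
  qed
qed

text \<open>Compares \<open>log |f(z) / z|\<close> with \<open>ln (m r / r)\<close>. At a critical
  point \<open>z f' / f\<close> is real and positive, so it equals its modulus. Where
  \<open>|f(z)| < m(|z|)\<close>, the bound on \<open>|f'|\<close> makes it at least
  \<open>r m' / m\<close>, which is the derivative inequality that the minimum principle asks
  for.\<close>

lemma starlike_growth:
  fixes m m' :: "real \<Rightarrow> real"
  assumes q: "q holomorphic_on ball 0 1" "q 0 = 1" "\<And>z. z \<in> ball 0 1 \<Longrightarrow> f z = z * q z"
    "\<And>z. z \<in> ball 0 1 \<Longrightarrow> q z \<noteq> 0" and pos: "\<And>z. z \<in> ball 0 1 \<Longrightarrow> 0 < Re (deriv f z / q z)"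
    and m: "m 0 = 0" "m' 0 = 1" "\<And>r. 0 \<le> r \<Longrightarrow> r < 1 \<Longrightarrow> (m has_real_derivative m' r) (at r)"
    and mpos: "\<And>r. 0 < r \<Longrightarrow> r < 1 \<Longrightarrow> 0 < m r"
    and low: "\<And>z. z \<in> ball 0 1 \<Longrightarrow> m' (cmod z) \<le> cmod (deriv f z)"
    and z: "z \<in> ball 0 1"
  shows "m (cmod z) \<le> cmod (f z)"
proof -
  obtain l where l: "l holomorphic_on ball 0 1" "l 0 = 0" "\<And>z. z \<in> ball 0 1 \<Longrightarrow> exp (l z) = q z"
    "\<And>z. z \<in> ball 0 1 \<Longrightarrow> deriv l z = deriv q z / q z"
    using holomorphic_log_on_disc[OF q(1,4,2)] by metis
  have nq: "cmod (q z) = exp (Re (l z))" if "z \<in> ball 0 1" for z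
    using l(3)[OF that] norm_exp_eq_Re by metis
  \<comment> \<open>The value at 0 is the continuous extension of \<open>ln (m r / r)\<close>,
    because \<open>m' 0 = 1\<close>.\<close>
  define g where "g r = (if r = 0 then 0 else ln (m r / r))" for r
  have dg: "(g has_real_derivative m' r / m r - 1 / r) (at r)" if r: "0 < r" "r < 1" for r
  proof -
    have "((\<lambda>r. ln (m r / r)) has_real_derivative m' r / m r - 1 / r) (at r)"
      using m(3)[of r] mpos[OF r] r
      by (auto intro!: derivative_eq_intros simp: divide_simps)
    then show ?thesis
      by (rule DERIV_cong_ev[OF refl _ refl, THEN iffD1, rotated])
         (use eventually_nhds_in_open[of "{0<..}" r] r in \<open>auto simp: g_def elim!: eventually_mono\<close>)
  qed
  have "g (cmod z) \<le> Re (l z)"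
  proof (rule disc_minimum_principle[where p = l and g = g and z = z and g' = "\<lambda>r. m' r / m r - 1 / r"])
    show "continuous_on {0..<1} g"
      unfolding continuous_on_eq_continuous_within
    proof
      fix r :: real assume r: "r \<in> {0..<1}"
      show "continuous (at r within {0..<1}) g"
      proof (cases "r = 0")
        case False
        with r show ?thesis
          using DERIV_isCont[OF dg[of r]] by (auto intro: continuous_at_imp_continuous_at_within)
      next
        case True
        have "((\<lambda>r. m r / r) \<longlongrightarrow> 1) (at 0)"
          using m(3)[of 0] m(1,2) by (simp add: has_field_derivative_iff)
        then have "((\<lambda>r. ln (m r / r)) \<longlongrightarrow> ln 1) (at 0)"
          by (intro tendsto_ln) auto
        then have "(g \<longlongrightarrow> 0) (at 0)"
          by (subst tendsto_cong[of _ "\<lambda>r. ln (m r / r)"])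
             (auto simp: g_def eventually_at intro!: exI[of _ 1])
        then show ?thesis
          using True by (auto simp: continuous_within g_def intro: tendsto_within_subset)
      qed
    qed
    fix z :: complex
    assume z: "z \<in> ball 0 1" "z \<noteq> 0" "Re (l z) < g (cmod z)" "Im (z * deriv l z) = 0"
    define R where "R = deriv f z / q z"
    have R: "z * deriv l z = R - 1"
    proof -
      have "deriv f z = q z + z * deriv q z" by (rule deriv_factor[OF q(1,3) z(1)])
      then show ?thesis
        using q(4)[OF z(1)] by (simp add: R_def l(4)[OF z(1)] add_divide_distrib)
    qed
    have "0 < Re R" using pos[OF z(1)] by (simp add: R_def)
    moreover have "Im R = 0" using z(4) by (simp add: R)
    ultimately have nR: "Re R = cmod R" by (simp add: cmod_def)
    have mz: "0 < m (cmod z)" using mpos[of "cmod z"] z by simp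
    have "exp (Re (l z)) < exp (g (cmod z))" using z by simp
    then have lt: "cmod (q z) < m (cmod z) / cmod z"
      using nq[OF z(1)] mz z(2) by (simp add: g_def)
    have "cmod z * (m' (cmod z) / m (cmod z)) = m' (cmod z) / (m (cmod z) / cmod z)" by simp
    also have "\<dots> \<le> cmod (deriv f z) / (m (cmod z) / cmod z)"
      using mz z by (intro divide_right_mono low) auto
    also have "\<dots> \<le> cmod (deriv f z) / cmod (q z)"
      using lt q(4)[OF z(1)] mz z(2) by (intro divide_left_mono mult_pos_pos) auto
    also have "\<dots> = Re R" using nR by (simp add: R_def norm_divide)
    finally show "cmod z * (m' (cmod z) / m (cmod z) - 1 / cmod z) \<le> Re (z * deriv l z)"
      using z(2) by (simp add: R right_diff_distrib)
  qed (use l dg z in \<open>auto simp: g_def\<close>)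
  show ?thesis
  proof (cases "z = 0")
    case False
    have "0 < m (cmod z)" using mpos[of "cmod z"] z False by simp
    then have "m (cmod z) / cmod z = exp (g (cmod z))" using False by (simp add: g_def)
    also have "\<dots> \<le> cmod (q z)" using \<open>g (cmod z) \<le> Re (l z)\<close> nq[OF z] by simp
    finally show ?thesis using False q(3)[OF z] by (simp add: norm_mult field_simps)
  qed (use m in auto)
qed

text \<open>Points of the frontier are limits of \<open>f(z)\<close> with \<open>|z| \<rightarrow> 1\<close>; the frontier is non-empty
  by Liouville's theorem, which matters because \<^term>\<open>infdist x {} = 0\<close>.\<close>

lemma le_boundary_dist:
  assumes holf: "f holomorphic_on ball 0 1" "f 0 = 0" and inj: "inj_on f (ball 0 1)"
    and low: "\<And>z. z \<in> ball 0 1 \<Longrightarrow> m (cmod z) \<le> cmod (f z)"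
    and mono: "\<And>r s. 0 \<le> r \<Longrightarrow> r \<le> s \<Longrightarrow> s < 1 \<Longrightarrow> m r \<le> m s"
    and lim: "(m \<longlongrightarrow> M) (at_left (1::real))"
  shows "M \<le> boundary_dist f"
proof -
  let ?D = "f ` ball 0 1"
  have contf: "continuous_on (ball 0 1) f" using holf holomorphic_on_imp_continuous_on by blast
  have op: "open ?D" using open_mapping_thm3[OF holf(1) _ inj] by simp
  have ne: "frontier ?D \<noteq> {}"
  proof
    assume "frontier ?D = {}"
    then have U: "?D = UNIV" using frontier_eq_empty[of ?D] by auto
    obtain g where g: "g holomorphic_on ?D" "\<And>z. z \<in> ball 0 1 \<Longrightarrow> g (f z) = z"
      using holomorphic_has_inverse[OF holf(1) open_ball inj] by metis
    have "range g \<subseteq> ball 0 1"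
    proof
      fix y assume "y \<in> range g"
      then obtain x where "y = g x" by auto
      moreover obtain z where "z \<in> ball 0 1" "x = f z" using U by (metis UNIV_I imageE)
      ultimately show "y \<in> ball 0 1" using g(2) by auto
    qed
    then have "bounded (range g)" using bounded_subset bounded_ball by blast
    then have "g constant_on UNIV" using Liouville_theorem g(1) U by metis
    then have "g (f 0) = g (f (1/2))" unfolding constant_on_def by auto
    then show False using g(2)[of 0] g(2)[of "1/2"] by simp
  qed
  have "M \<le> dist (f 0) y" if y: "y \<in> frontier ?D" for y
  proof (rule ccontr)
    assume "\<not> M \<le> dist (f 0) y"
    then have "cmod y < M" by (simp add: holf(2))
    then have "\<forall>\<^sub>F r in at_left 1. cmod y < m r" using order_tendstoD(1)[OF lim] by blast
    moreover have "\<forall>\<^sub>F r in at_left 1. (0::real) < r \<and> r < 1"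
      using eventually_at_left[of 0 "1::real"] by (auto intro: exI[of _ 0])
    ultimately have "\<forall>\<^sub>F r in at_left 1. cmod y < m r \<and> (0::real) < r \<and> r < 1"
      by (rule eventually_conj)
    then obtain r where r: "cmod y < m r" "0 < r" "r < 1"
      using eventually_happens'[of "at_left (1::real)"] trivial_limit_at_left_real by blast
    \<comment> \<open>The right-hand side is closed, so it contains \<open>y\<close>. As
      \<open>|y| < m r\<close>, \<open>y\<close> would be a value of \<open>f\<close> on
      \<open>cball 0 r\<close>, but no frontier point of the open image is a value.\<close>
    have sub: "?D \<subseteq> f ` cball 0 r \<union> {x. m r \<le> cmod x}"
    proof (rule image_subsetI)
      fix z :: complex assume z: "z \<in> ball 0 1"
      show "f z \<in> f ` cball 0 r \<union> {x. m r \<le> cmod x}"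
      proof (cases "cmod z \<le> r")
        case False
        then have "m r \<le> m (cmod z)" using z r by (intro mono) auto
        then show ?thesis using low[OF z] by simp
      qed auto
    qed
    have csub: "cball 0 r \<subseteq> ball (0::complex) 1" using r by auto
    have "compact (f ` cball 0 r)"
      by (rule compact_continuous_image[OF continuous_on_subset[OF contf csub]]) simp
    then have "closed (f ` cball 0 r \<union> {x. m r \<le> cmod x})"
      by (intro closed_Un compact_imp_closed closed_Collect_le continuous_intros)
    then have "closure ?D \<subseteq> f ` cball 0 r \<union> {x. m r \<le> cmod x}"
      using sub closure_minimal by blast
    moreover have "y \<in> closure ?D" "y \<notin> ?D"
      using y op by (auto simp: frontier_def interior_open)
    ultimately show False using r csub by auto
  qed
  then show "M \<le> boundary_dist f"
    unfolding boundary_dist_def infdist_notempty[OF ne] by (intro cINF_greatest[OF ne])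
qed

section \<open>Ma-Minda functions\<close>

lemma disc_fps:
  assumes "f holomorphic_on ball 0 1"
  shows "f has_fps_expansion fps_expansion f 0"
  using assms by (intro has_fps_expansion_fps_expansion[of "ball 0 1"]) auto

lemma taylor_sums:
  assumes "f holomorphic_on ball 0 1" "z \<in> ball 0 1"
  shows "(\<lambda>n. taylor_coeff f n * z ^ n) sums f z"
  unfolding taylor_coeff_def
  by (rule has_fps_expansion_imp_sums_complex[where r = 1, OF disc_fps]) (use assms in auto)

lemma taylor_coeff_cong:
  assumes "\<And>z. z \<in> ball 0 1 \<Longrightarrow> f z = g z"
  shows "taylor_coeff f n = taylor_coeff g n"
proof -
  have "eventually (\<lambda>z. f z = g z) (nhds 0)"
    using eventually_nhds_in_open[of "ball 0 1" "0::complex"] assms by (auto elim!: eventually_mono)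
  then show ?thesis unfolding taylor_coeff_deriv by (simp add: higher_deriv_cong_ev)
qed

lemma cnj_symmetric_imp_real_coeff:
  assumes holo: "f holomorphic_on ball 0 1" and sym: "\<And>z. z \<in> ball 0 1 \<Longrightarrow> f (cnj z) = cnj (f z)"
  shows "taylor_coeff f n \<in> \<real>"
proof -
  define F where "F = Abs_fps (\<lambda>n. cnj (taylor_coeff f n))"
  have "f has_fps_expansion F"
  proof (rule has_fps_expansionI)
    have "(\<lambda>n. fps_nth F n * u ^ n) sums f u" if "u \<in> ball 0 1" for u
    proof -
      have "(\<lambda>n. taylor_coeff f n * cnj u ^ n) sums f (cnj u)"
        using that by (intro taylor_sums holo) auto
      then have "(\<lambda>n. cnj (taylor_coeff f n * cnj u ^ n)) sums cnj (f (cnj u))"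
        by (simp only: sums_cnj)
      then show ?thesis using sym[OF that] by (simp add: F_def)
    qed
    then show "\<forall>\<^sub>F u in nhds 0. (\<lambda>n. fps_nth F n * u ^ n) sums f u"
      using eventually_nhds_in_open[of "ball 0 1" "0::complex"] by (auto elim!: eventually_mono)
  qed
  then have "fps_expansion f 0 = F" by (rule fps_expansion_eqI)
  then have "taylor_coeff f n = cnj (taylor_coeff f n)"
    by (metis F_def fps_nth_Abs_fps taylor_coeff_def)
  then show ?thesis by (metis Reals_cnj_iff)
qed

lemma real_coeff_imp_cnj_symmetric:
  assumes holo: "f holomorphic_on ball 0 1" and re: "\<And>n. taylor_coeff f n \<in> \<real>"
    and z: "z \<in> ball 0 1"
  shows "f (cnj z) = cnj (f z)"
proof -
  have "(\<lambda>n. cnj (taylor_coeff f n * z ^ n)) sums cnj (f z)"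
    using taylor_sums[OF holo z] by (simp only: sums_cnj)
  then have "(\<lambda>n. taylor_coeff f n * cnj z ^ n) sums cnj (f z)"
    using re by (simp add: Reals_cnj_iff)
  moreover have "(\<lambda>n. taylor_coeff f n * cnj z ^ n) sums f (cnj z)"
    using z by (intro taylor_sums holo) auto
  ultimately show ?thesis by (metis sums_unique2)
qed

lemma connected_nonzero_pos:
  fixes u :: "'a::topological_space \<Rightarrow> real"
  assumes "connected S" "continuous_on S u" "\<And>x. x \<in> S \<Longrightarrow> u x \<noteq> 0" "a \<in> S" "0 < u a" "x \<in> S"
  shows "0 < u x"
proof (rule ccontr)
  assume "\<not> 0 < u x"
  then have "0 \<in> u ` S"
    using connectedD_interval[OF connected_continuous_image[OF assms(2,1)], of "u x" "u a" 0] assms by auto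
  then show False using assms(3) by auto
qed

lemma real_coeff_pos_on_reals:
  assumes holo: "p holomorphic_on ball 0 1" and re: "\<And>n. taylor_coeff p n \<in> \<real>"
    and nz: "\<And>z. z \<in> ball 0 1 \<Longrightarrow> p z \<noteq> 0" and pos: "0 < Re (p 0)" and x: "\<bar>x\<bar> < 1"
  shows "Im (p (of_real x)) = 0" "0 < Re (p (of_real x))"
proof -
  have im: "Im (p (of_real x)) = 0" if "\<bar>x\<bar> < 1" for x
    using real_coeff_imp_cnj_symmetric[OF holo re, of "of_real x"] that
    by (metis complex_cnj_complex_of_real Reals_cnj_iff complex_is_Real_iff mem_ball_0 norm_of_real)
  then show "Im (p (of_real x)) = 0" using x by blast
  show "0 < Re (p (of_real x))"
  proof (rule connected_nonzero_pos[of "{-1<..<1}" "\<lambda>x. Re (p (of_real x))" 0])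
    show "continuous_on {-1<..<1} (\<lambda>x. Re (p (complex_of_real x)))"
      by (intro continuous_intros continuous_on_compose2[OF holomorphic_on_imp_continuous_on[OF holo]]) auto
    show "Re (p (complex_of_real x)) \<noteq> 0" if "x \<in> {-1<..<1}" for x
      using im[of x] nz[of "of_real x"] that by (auto simp: complex_eq_iff abs_less_iff)
  qed (use x pos in auto)
qed

lemma ma_minda_holomorphic: "ma_minda \<psi> \<Longrightarrow> \<psi> holomorphic_on ball 0 1"
  by (simp add: ma_minda_def)

text \<open>By Schwarz's lemma the univalent map \<open>\<psi>\<close> is determined by its image, the value at 0 and the
  argument of its derivative there, so the symmetry of the image is inherited by \<open>\<psi>\<close>.\<close>

lemma ma_minda_cnj:
  assumes mm: "ma_minda \<psi>" and z: "z \<in> ball 0 1"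
  shows "\<psi> (cnj z) = cnj (\<psi> z)"
proof -
  have hol: "\<psi> holomorphic_on ball 0 1" and inj: "inj_on \<psi> (ball 0 1)" and [simp]: "\<psi> 0 = 1"
    and sym: "\<And>w. w \<in> \<psi> ` ball 0 1 \<Longrightarrow> cnj w \<in> \<psi> ` ball 0 1"
    and d: "Im (deriv \<psi> 0) = 0" "0 < Re (deriv \<psi> 0)"
    using mm by (auto simp: ma_minda_def)
  obtain g where g: "g holomorphic_on \<psi> ` ball 0 1"
    "\<And>z. z \<in> ball 0 1 \<Longrightarrow> deriv \<psi> z * deriv g (\<psi> z) = 1" "\<And>z. z \<in> ball 0 1 \<Longrightarrow> g (\<psi> z) = z"
    using holomorphic_has_inverse[OF hol open_ball inj] by metis
  define c where "c = cnj \<circ> \<psi> \<circ> cnj"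
  have img: "cnj ` ball 0 1 = ball (0::complex) 1"
    by (simp add: image_cnj_conv_vimage_cnj set_eq_iff)
  have holc: "c holomorphic_on ball 0 1"
    unfolding c_def using holomorphic_on_compose_cnj_cnj[of \<psi> "ball 0 1"] hol img by simp
  have cin: "c z \<in> \<psi> ` ball 0 1" if "z \<in> ball 0 1" for z
    using that by (auto simp: c_def intro!: sym)
  \<comment> \<open>\<open>c\<close> is \<psi> conjugated by reflection and has its values in the
    image of \<psi>. So \<open>e\<close> is a self-map of the disc fixing 0, with derivative 1 there
    because \<psi>'(0) is real, and Schwarz's lemma makes it the identity.\<close>
  define e where "e = g \<circ> c"
  have hole: "e holomorphic_on ball 0 1"
    unfolding e_def by (rule holomorphic_on_compose_gen[OF holc g(1)]) (use cin in auto)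
  have pe: "e z \<in> ball 0 1 \<and> \<psi> (e z) = c z" if z: "z \<in> ball 0 1" for z
  proof -
    obtain y where "y \<in> ball 0 1" "c z = \<psi> y" using cin[OF z] by auto
    then show ?thesis using g(3) by (simp add: e_def)
  qed
  have e0: "e 0 = 0" using g(3)[of 0] by (simp add: e_def c_def)
  have "(c has_field_derivative deriv \<psi> 0) (at 0)"
  proof -
    have "(c has_field_derivative cnj (deriv \<psi> 0)) (at 0)"
      unfolding c_def
      using has_field_derivative_cnj_cnj[of \<psi> "deriv \<psi> 0" 0] holomorphic_derivI[OF hol open_ball, of 0]
      by (simp add: o_def)
    moreover have "cnj (deriv \<psi> 0) = deriv \<psi> 0" using d by (simp add: complex_eq_iff)
    ultimately show ?thesis by simp
  qed
  moreover have "open (\<psi> ` ball 0 1)" using open_mapping_thm3[OF hol open_ball inj] .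
  then have "(g has_field_derivative deriv g 1) (at (c 0))"
    using g(1) holomorphic_derivI[of g "\<psi> ` ball 0 1" "c 0"] cin[of 0] by (simp add: c_def)
  ultimately have "(e has_field_derivative deriv g 1 * deriv \<psi> 0) (at 0)"
    unfolding e_def by (intro DERIV_chain) auto
  then have de: "deriv e 0 = 1"
    using g(2)[of 0] by (simp add: DERIV_imp_deriv mult.commute)
  obtain \<alpha> where \<alpha>: "\<And>z. cmod z < 1 \<Longrightarrow> e z = \<alpha> * z"
    using Schwarz_Lemma(3)[OF hole e0, of 0] pe de by auto
  have "deriv e 0 = \<alpha>"
  proof -
    have "((\<lambda>z. \<alpha> * z) has_field_derivative \<alpha>) (at 0)" by (auto intro!: derivative_eq_intros)
    then have "(e has_field_derivative \<alpha>) (at 0)"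
      by (rule DERIV_cong_ev[OF refl _ refl, THEN iffD1, rotated])
         (use eventually_nhds_in_open[of "ball 0 1" "0::complex"] \<alpha> in \<open>auto elim!: eventually_mono\<close>)
    then show ?thesis by (rule DERIV_imp_deriv)
  qed
  then have "e z = z" using \<alpha>[of z] de z by simp
  then have "\<psi> z = cnj (\<psi> (cnj z))" using pe[OF z] by (simp add: c_def)
  then show ?thesis by simp
qed

lemma ma_minda_real_coeff: "ma_minda \<psi> \<Longrightarrow> taylor_coeff \<psi> n \<in> \<real>"
  by (intro cnj_symmetric_imp_real_coeff ma_minda_cnj ma_minda_holomorphic)

text \<open>As \<psi> commutes with conjugation, a real value is taken at \<open>z\<close> and at
  its conjugate, and univalence identifies the two.\<close>

lemma ma_minda_real_value_iff:
  assumes mm: "ma_minda \<psi>" and z: "z \<in> ball 0 1"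
  shows "Im (\<psi> z) = 0 \<longleftrightarrow> Im z = 0"
proof -
  have "Im (\<psi> z) = 0 \<longleftrightarrow> \<psi> (cnj z) = \<psi> z"
    using ma_minda_cnj[OF assms] by (auto simp: complex_eq_iff)
  also have "\<dots> \<longleftrightarrow> cnj z = z"
    using mm z by (auto simp: ma_minda_def inj_on_def)
  also have "\<dots> \<longleftrightarrow> Im z = 0" by (auto simp: complex_eq_iff)
  finally show ?thesis .
qed

text \<open>\<open>Im \<psi>\<close> has no zero in the upper half-disc and so keeps its sign there.
  Were it negative, \<open>- \<psi>\<close> would satisfy the hypotheses of
  \<open>typically_real_coeff\<close>, whose case \<open>n = 1\<close> contradicts \<psi>'(0) >
  0.\<close>

lemma ma_minda_typically_real:
  assumes mm: "ma_minda \<psi>" and z: "z \<in> ball 0 1"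
  shows "0 \<le> Im (\<psi> z) * Im z"
proof -
  have hol: "\<psi> holomorphic_on ball 0 1" using mm by (rule ma_minda_holomorphic)
  define U where "U = ball (0::complex) 1 \<inter> {z. 0 < Im z}"
  have "convex U" unfolding U_def by (intro convex_Int convex_ball convex_halfspace_Im_gt)
  then have con: "connected U" by (rule convex_connected)
  have cU: "continuous_on U (\<lambda>z. Im (\<psi> z))"
    using holomorphic_on_imp_continuous_on[OF hol] unfolding U_def
    by (intro continuous_intros) (auto intro: continuous_on_subset)
  have nz: "Im (\<psi> z) \<noteq> 0" if "z \<in> U" for z
    using that ma_minda_real_value_iff[OF mm, of z] by (auto simp: U_def)
  have lower: "Im (\<psi> (cnj z)) * Im (cnj z) = Im (\<psi> z) * Im z" if "z \<in> ball 0 1" for z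
    using ma_minda_cnj[OF mm that] by simp
  have sgn: "0 \<le> s * (Im (\<psi> z) * Im z)"
    if s: "\<And>z. z \<in> U \<Longrightarrow> 0 < s * Im (\<psi> z)" and z: "z \<in> ball 0 1" for s z
  proof -
    consider "z \<in> U" | "cnj z \<in> U" | "Im z = 0" using z by (force simp: U_def)
    then show ?thesis
    proof cases
      case 1
      then show ?thesis using s[OF 1] by (simp add: U_def flip: mult.assoc)
    next
      case 2
      then have "0 \<le> (s * Im (\<psi> (cnj z))) * Im (cnj z)"
        using mult_nonneg_nonneg[OF less_imp_le[OF s[OF 2]], of "Im (cnj z)"] 2 by (simp add: U_def)
      then show ?thesis using lower[OF z] by (simp only: mult.assoc)
    qed auto
  qed
  show ?thesis
  proof (cases "\<exists>a\<in>U. 0 < Im (\<psi> a)")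
    case True
    then obtain a where "a \<in> U" "0 < Im (\<psi> a)" by auto
    then have "0 < 1 * Im (\<psi> z)" if "z \<in> U" for z
      using connected_nonzero_pos[OF con cU nz _ _ that] by simp
    from sgn[OF this z] show ?thesis by simp
  next
    case False
    then have neg: "0 < (-1) * Im (\<psi> z)" if "z \<in> U" for z
      using nz[OF that] that by force
    have "\<bar>Re (taylor_coeff (\<lambda>z. - \<psi> z) 1)\<bar> \<le> real 1 * Re (deriv (\<lambda>z. - \<psi> z) 0)"
      using sgn[OF neg] hol by (intro typically_real_coeff holomorphic_intros) auto
    moreover have "deriv (\<lambda>z. - \<psi> z) 0 = - deriv \<psi> 0"
      using holomorphic_derivI[OF hol open_ball, of 0] by (intro DERIV_imp_deriv DERIV_minus) auto
    ultimately show ?thesis using mm by (simp add: ma_minda_def)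
  qed
qed

lemma ma_minda_coeff_le:
  assumes mm: "ma_minda \<psi>" and "n > 0"
  shows "cmod (taylor_coeff \<psi> n) \<le> real n * Re (deriv \<psi> 0)"
proof -
  have "cmod (taylor_coeff \<psi> n) = \<bar>Re (taylor_coeff \<psi> n)\<bar>"
    using ma_minda_real_coeff[OF mm, of n] by (metis Reals_cases Re_complex_of_real norm_of_real)
  then show ?thesis
    using typically_real_coeff[OF ma_minda_holomorphic[OF mm] ma_minda_typically_real[OF mm] \<open>n > 0\<close>] by simp
qed

lemma ma_minda_deriv_le_2:
  assumes mm: "ma_minda \<psi>"
  shows "Re (deriv \<psi> 0) \<le> 2"
proof -
  have "cmod (taylor_coeff \<psi> 1) \<le> 2 * Re (\<psi> 0)"
    using mm by (intro caratheodory_coeff) (auto simp: ma_minda_def intro: less_imp_le)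
  then have "cmod (deriv \<psi> 0) \<le> 2" using mm by (simp add: ma_minda_def)
  then show ?thesis using complex_Re_le_cmod order_trans by blast
qed

text \<open>On (-1, 1) the derivative is real and, by univalence, nonzero, so it keeps the positive
  sign it has at 0.\<close>

lemma ma_minda_strict_mono:
  assumes mm: "ma_minda \<psi>" and "-1 < x" "x < y" "y < 1"
  shows "Re (\<psi> (of_real x)) < Re (\<psi> (of_real y))"
proof (rule DERIV_pos_imp_increasing[of x y "\<lambda>x. Re (\<psi> (of_real x))"])
  have hol: "\<psi> holomorphic_on ball 0 1" using mm by (rule ma_minda_holomorphic)
  fix s assume s: "x \<le> s" "s \<le> y"
  then have sb: "\<bar>s\<bar> < 1" using assms by auto
  have "0 < Re (deriv \<psi> (of_real s))"
  proof (rule real_coeff_pos_on_reals(2)[of "deriv \<psi>"])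
    show "deriv \<psi> holomorphic_on ball 0 1" using hol by (intro holomorphic_deriv) auto
    show "taylor_coeff (deriv \<psi>) n \<in> \<real>" for n
      unfolding taylor_coeff_deriv_fun using ma_minda_real_coeff[OF mm] by (intro Reals_mult) auto
    show "deriv \<psi> z \<noteq> 0" if "z \<in> ball 0 1" for z
      using holomorphic_injective_imp_regular[OF hol open_ball _ that] mm by (simp add: ma_minda_def)
  qed (use mm sb in \<open>auto simp: ma_minda_def\<close>)
  moreover have "((\<lambda>x. Re (\<psi> (of_real x))) has_real_derivative Re (1 * deriv \<psi> (of_real s))) (at s)"
    by (rule Re_curve_derivative)
       (use sb holomorphic_derivI[OF hol open_ball] in \<open>auto intro!: derivative_eq_intros\<close>)
  ultimately show "\<exists>d. ((\<lambda>x. Re (\<psi> (of_real x))) has_real_derivative d) (at s) \<and> 0 < d"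
    by auto
qed fact

section \<open>The equation \<open>z F' = F G\<close> for formal power series\<close>

lemma fps_ode_nth:
  fixes F G :: "'a :: field_char_0 fps"
  assumes "fps_X * fps_deriv F = F * G" "fps_nth G 0 = 0" "n > 0"
  shows "of_nat n * fps_nth F n = (\<Sum>i<n. fps_nth F i * fps_nth G (n - i))"
proof -
  have "of_nat n * fps_nth F n = fps_nth (fps_X * fps_deriv F) n"
    using \<open>n > 0\<close> by simp
  also have "\<dots> = (\<Sum>i\<le>n. fps_nth F i * fps_nth G (n - i))"
    unfolding assms(1) fps_mult_nth by (simp add: atLeast0AtMost)
  also have "{..n} = insert n {..<n}" by auto
  finally show ?thesis using assms(2) by simp
qed

text \<open>Since \<open>G\<close> has no constant term, the recursion determines each coefficient
  from the earlier ones. This is how \<open>f'\<close> is later identified with the product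
  \<open>f0'(c z) exp E(z)\<close>.\<close>

lemma fps_ode_unique:
  fixes F F' G :: "'a :: field_char_0 fps"
  assumes "fps_X * fps_deriv F = F * G" "fps_X * fps_deriv F' = F' * G" "fps_nth G 0 = 0"
    and "fps_nth F 0 = fps_nth F' 0"
  shows "F = F'"
proof (rule fps_ext)
  fix n show "fps_nth F n = fps_nth F' n"
  proof (induction n rule: less_induct)
    case (less n)
    show ?case
    proof (cases "n = 0")
      case False
      then have "of_nat n * fps_nth F n = of_nat n * fps_nth F' n"
        using less fps_ode_nth[OF assms(1,3), of n] fps_ode_nth[OF assms(2,3), of n] by simp
      then show ?thesis using False by simp
    qed (use assms in auto)
  qed
qed

lemma convex_ode_fps:
  assumes holf: "f holomorphic_on ball 0 1" and nz: "\<And>z. z \<in> ball 0 1 \<Longrightarrow> deriv f z \<noteq> 0"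
    and eq: "\<And>z. z \<in> ball 0 1 \<Longrightarrow> convexity_quotient f z = 1 + p z" and holp: "p holomorphic_on ball 0 1"
  shows "fps_X * fps_deriv (fps_expansion (deriv f) 0) = fps_expansion (deriv f) 0 * fps_expansion p 0"
proof -
  have hol': "deriv f holomorphic_on ball 0 1" using holf by (intro holomorphic_deriv) auto
  have "(\<lambda>z. z * deriv (deriv f) z) has_fps_expansion fps_X * fps_deriv (fps_expansion (deriv f) 0)"
    by (intro fps_expansion_intros disc_fps hol')
  moreover have "(\<lambda>z. deriv f z * p z) has_fps_expansion fps_expansion (deriv f) 0 * fps_expansion p 0"
    by (intro fps_expansion_intros disc_fps hol' holp)
  then have "(\<lambda>z. z * deriv (deriv f) z) has_fps_expansion fps_expansion (deriv f) 0 * fps_expansion p 0"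
  proof (rule has_fps_expansion_cong[THEN iffD1, rotated 2])
    have "deriv f z * p z = z * deriv (deriv f) z" if "z \<in> ball 0 1" for z
      using eq[OF that] nz[OF that] by (simp add: convexity_quotient_def field_simps)
    then show "\<forall>\<^sub>F z in nhds 0. deriv f z * p z = z * deriv (deriv f) z"
      using eventually_nhds_in_open[of "ball 0 1" "0::complex"] by (auto elim!: eventually_mono)
  qed simp
  ultimately show ?thesis by (metis fps_expansion_eqI)
qed

section \<open>The extremal convex function and the covering radius\<close>

locale ma_minda_extremal =
  fixes \<psi> f0 :: "complex \<Rightarrow> complex"
  assumes mm: "ma_minda \<psi>" and ext: "convex_extremal \<psi> f0"
begin

lemma f0_holomorphic: "f0 holomorphic_on ball 0 1"
  and f0_0: "f0 0 = 0" and deriv_f0_0: "deriv f0 0 = 1"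
  and deriv_f0_nonzero: "z \<in> ball 0 1 \<Longrightarrow> deriv f0 z \<noteq> 0"
  and f0_quotient: "z \<in> ball 0 1 \<Longrightarrow> convexity_quotient f0 z = \<psi> z"
  using ext by (auto simp: convex_extremal_def classA_def)

lemma deriv_f0_holomorphic: "deriv f0 holomorphic_on ball 0 1"
  using f0_holomorphic by (intro holomorphic_deriv) auto

lemma psi_0: "\<psi> 0 = 1" and psi_holomorphic: "\<psi> holomorphic_on ball 0 1"
  using mm by (auto simp: ma_minda_def)

lemma phi_holomorphic: "(\<lambda>z. \<psi> z - 1) holomorphic_on ball 0 1"
  using psi_holomorphic by (intro holomorphic_intros)

lemma phi_coeff:
  "taylor_coeff (\<lambda>z. \<psi> z - 1) n = (if n = 0 then 0 else taylor_coeff \<psi> n)"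
proof -
  have "(\<lambda>z. \<psi> z - 1) has_fps_expansion fps_expansion \<psi> 0 - 1"
    by (intro fps_expansion_intros disc_fps psi_holomorphic)
  then have "fps_expansion (\<lambda>z. \<psi> z - 1) 0 = fps_expansion \<psi> 0 - 1"
    by (rule fps_expansion_eqI)
  then have "taylor_coeff (\<lambda>z. \<psi> z - 1) n = taylor_coeff \<psi> n - (if n = 0 then 1 else 0)"
    by (simp add: taylor_coeff_def)
  then show ?thesis using psi_0 by simp
qed

lemma f0_fps_ode:
  "fps_X * fps_deriv (fps_expansion (deriv f0) 0)
     = fps_expansion (deriv f0) 0 * fps_expansion (\<lambda>z. \<psi> z - 1) 0"
  by (rule convex_ode_fps[OF f0_holomorphic deriv_f0_nonzero _ phi_holomorphic]) (simp_all add: f0_quotient)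

text \<open>The recursion for the coefficients of \<open>f0'\<close> transfers reality from the
  coefficients of \<psi>.\<close>

lemma deriv_f0_real_coeff: "taylor_coeff (deriv f0) n \<in> \<real>"
proof (induction n rule: less_induct)
  case (less n)
  show ?case
  proof (cases "n = 0")
    case False
    have "of_nat n * taylor_coeff (deriv f0) n
       = (\<Sum>i<n. taylor_coeff (deriv f0) i * taylor_coeff (\<lambda>z. \<psi> z - 1) (n - i))"
      unfolding taylor_coeff_def
      by (rule fps_ode_nth[OF f0_fps_ode]) (use False phi_coeff[of 0] in \<open>auto simp: taylor_coeff_def\<close>)
    also have "\<dots> \<in> \<real>"
      by (intro sum_in_Reals Reals_mult less) (auto simp: phi_coeff ma_minda_real_coeff[OF mm])
    finally have "of_nat n * taylor_coeff (deriv f0) n / of_nat n \<in> \<real>"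
      by (intro Reals_divide) auto
    then show ?thesis using False by simp
  qed (simp add: deriv_f0_0)
qed

lemma f0_real_coeff: "taylor_coeff f0 n \<in> \<real>"
proof (cases n)
  case (Suc m)
  have "of_nat (Suc m) * taylor_coeff f0 (Suc m) / of_nat (Suc m) \<in> \<real>"
    using deriv_f0_real_coeff[of m] unfolding taylor_coeff_deriv_fun
    by (intro Reals_divide Reals_of_nat)
  then show ?thesis using Suc by (simp del: of_nat_Suc)
qed (simp add: f0_0)

text \<open>This is \<open>-f0(-r)\<close>; the real part only fixes the type, as \<open>f0\<close>
  is real on (-1, 1) by \<open>f0_minor\<close>.\<close>

definition minor :: "real \<Rightarrow> real" where "minor r = - Re (f0 (- of_real r))"

definition minor' :: "real \<Rightarrow> real" where "minor' r = Re (deriv f0 (- of_real r))"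

lemma deriv_f0_real: "\<bar>x\<bar> < 1 \<Longrightarrow> Im (deriv f0 (of_real x)) = 0"
  and deriv_f0_pos: "\<bar>x\<bar> < 1 \<Longrightarrow> 0 < Re (deriv f0 (of_real x))"
  by (rule real_coeff_pos_on_reals[OF deriv_f0_holomorphic deriv_f0_real_coeff deriv_f0_nonzero];
      simp add: deriv_f0_0)+

lemma minor'_pos: "\<bar>r\<bar> < 1 \<Longrightarrow> 0 < minor' r"
  using deriv_f0_pos[of "- r"] by (simp add: minor'_def)

lemma deriv_f0_minor': "\<bar>r\<bar> < 1 \<Longrightarrow> deriv f0 (- of_real r) = of_real (minor' r)"
  using deriv_f0_real[of "- r"] by (simp add: minor'_def complex_eq_iff)

lemma f0_real: "\<bar>x\<bar> < 1 \<Longrightarrow> Im (f0 (of_real x)) = 0"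
  using real_coeff_imp_cnj_symmetric[OF f0_holomorphic f0_real_coeff, of "of_real x"]
  by (simp add: complex_eq_iff)

lemma f0_minor: "\<bar>r\<bar> < 1 \<Longrightarrow> f0 (- of_real r) = - of_real (minor r)"
  using f0_real[of "- r"] by (simp add: minor_def complex_eq_iff)

lemma minor_has_derivative:
  assumes "\<bar>r\<bar> < 1"
  shows "(minor has_real_derivative minor' r) (at r)"
proof -
  have "((\<lambda>s. - of_real s) has_vector_derivative (- 1 :: complex)) (at r)"
    by (auto intro!: derivative_eq_intros)
  from Re_curve_derivative[OF this, of f0 "deriv f0 (- of_real r)"]
  have "((\<lambda>s. Re (f0 (- of_real s))) has_real_derivative Re (- deriv f0 (- of_real r))) (at r)"
    using assms holomorphic_derivI[OF f0_holomorphic open_ball] by simp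
  from DERIV_minus[OF this] show ?thesis
    by (simp add: minor_def[abs_def] minor'_def)
qed

lemma minor_0: "minor 0 = 0" and minor'_0: "minor' 0 = 1"
  by (simp_all add: minor_def minor'_def f0_0 deriv_f0_0)

lemma ln_minor'_has_derivative:
  assumes "0 < r" "r < 1"
  shows "((\<lambda>r. ln (minor' r)) has_real_derivative (Re (\<psi> (- of_real r)) - 1) / r) (at r)"
proof -
  define z where "z = - complex_of_real r"
  have z: "z \<in> ball 0 1" using assms by (simp add: z_def)
  have "((\<lambda>s. - of_real s) has_vector_derivative (- 1 :: complex)) (at r)"
    by (auto intro!: derivative_eq_intros)
  from Re_curve_derivative[OF this, of "deriv f0" "deriv (deriv f0) (- of_real r)"]
  have d: "(minor' has_real_derivative - Re (deriv (deriv f0) z)) (at r)"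
    using assms holomorphic_derivI[OF deriv_f0_holomorphic open_ball]
    by (simp add: minor'_def[abs_def] z_def)
  have "z * deriv (deriv f0) z = deriv f0 z * (\<psi> z - 1)"
    using f0_quotient[OF z] deriv_f0_nonzero[OF z] by (simp add: convexity_quotient_def field_simps)
  then have "Re (z * deriv (deriv f0) z) = Re (of_real (minor' r) * (\<psi> z - 1))"
    using deriv_f0_minor'[of r] assms by (simp add: z_def)
  then have "- r * Re (deriv (deriv f0) z) = minor' r * (Re (\<psi> z) - 1)"
    by (simp add: z_def)
  then have "- Re (deriv (deriv f0) z) / minor' r = (Re (\<psi> z) - 1) / r"
    using assms minor'_pos[of r] by (simp add: field_simps)
  moreover have "((\<lambda>r. ln (minor' r)) has_real_derivative - Re (deriv (deriv f0) z) / minor' r) (at r)"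
    using d minor'_pos[of r] assms by (auto intro!: derivative_eq_intros)
  ultimately show ?thesis by (simp add: z_def)
qed

lemma continuous_ln_minor': "continuous_on {0..<1} (\<lambda>r. ln (minor' r))"
  unfolding minor'_def
  by (intro continuous_intros continuous_on_compose2[OF holomorphic_on_imp_continuous_on[OF deriv_f0_holomorphic]])
     (use minor'_pos in \<open>auto simp: minor'_def less_imp_neq[symmetric]\<close>)

text \<open>At a critical point of \<open>log |f'|\<close> on a circle, \<open>z f''(z) / f'(z) = \<psi>(w(z)) - 1\<close> is real, hence
  so is \<open>w(z)\<close>, and on the real axis \<open>\<psi>\<close> is increasing.\<close>

lemma classC_deriv_lower_bound:
  assumes f: "classC \<psi> f" and z: "z \<in> ball 0 1"
  shows "minor' (cmod z) \<le> cmod (deriv f z)"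
proof -
  have holf: "f holomorphic_on ball 0 1" and f0: "deriv f 0 = 1"
    and nz: "\<And>z. z \<in> ball 0 1 \<Longrightarrow> deriv f z \<noteq> 0"
    using f by (auto simp: classC_def classA_def)
  obtain w where w: "schwarz_function w" "\<And>z. z \<in> ball 0 1 \<Longrightarrow> convexity_quotient f z = \<psi> (w z)"
    using f by (auto simp: classC_def subordinate_def)
  have wle: "cmod (w z) \<le> cmod z" if "z \<in> ball 0 1" for z
    using w(1) that Schwarz_Lemma(1)[of w z] by (force simp: schwarz_function_def)
  have hol': "deriv f holomorphic_on ball 0 1" using holf by (intro holomorphic_deriv) auto
  obtain l where l: "l holomorphic_on ball 0 1" "l 0 = 0" "\<And>z. z \<in> ball 0 1 \<Longrightarrow> exp (l z) = deriv f z"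
    "\<And>z. z \<in> ball 0 1 \<Longrightarrow> deriv l z = deriv (deriv f) z / deriv f z"
    using holomorphic_log_on_disc[OF hol' nz f0] by metis
  have "ln (minor' (cmod z)) \<le> Re (l z)"
  proof (rule disc_minimum_principle[where p = l and g = "\<lambda>r. ln (minor' r)" and z = z
        and g' = "\<lambda>r. (Re (\<psi> (- of_real r)) - 1) / r", OF l(1) continuous_ln_minor' ln_minor'_has_derivative])
    fix z :: complex assume *: "z \<in> ball 0 1" "z \<noteq> 0" "Im (z * deriv l z) = 0"
    have q: "z * deriv l z = \<psi> (w z) - 1"
      using w(2)[OF *(1)] l(4)[OF *(1)] by (simp add: convexity_quotient_def algebra_simps)
    have wz: "w z \<in> ball 0 1" using wle[OF *(1)] *(1) by simp
    have "Im (\<psi> (w z)) = 0" using *(3) unfolding q by simp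
    then have wr: "w z = of_real (Re (w z))"
      using ma_minda_real_value_iff[OF mm wz] by (simp add: complex_eq_iff)
    have "- cmod z \<le> Re (w z)"
      using wle[OF *(1)] abs_Re_le_cmod[of "w z"] by linarith
    moreover have "\<bar>Re (w z)\<bar> < 1" using wz abs_Re_le_cmod[of "w z"] by simp
    ultimately have "Re (\<psi> (of_real (- cmod z))) \<le> Re (\<psi> (of_real (Re (w z))))"
      using ma_minda_strict_mono[OF mm, of "- cmod z" "Re (w z)"] *(1)
      by (cases "- cmod z = Re (w z)") (auto simp: abs_less_iff)
    then show "cmod z * ((Re (\<psi> (- of_real (cmod z))) - 1) / cmod z) \<le> Re (z * deriv l z)"
      using *(2) wr unfolding q by simp
  qed (use l minor'_0 z in auto)
  then have "exp (ln (minor' (cmod z))) \<le> exp (Re (l z))" by simp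
  also have "exp (Re (l z)) = cmod (deriv f z)" using l(3)[OF z] norm_exp_eq_Re by metis
  finally show ?thesis using minor'_pos[of "cmod z"] z by simp
qed

lemma f0_classC: "classC \<psi> f0"
  unfolding classC_def subordinate_def schwarz_function_def
  using ext by (auto simp: convex_extremal_def intro!: exI[of _ "\<lambda>z. z"] holomorphic_intros)

lemma minor_less:
  assumes "0 \<le> r" "r < s" "s < 1"
  shows "minor r < minor s"
  by (rule DERIV_pos_imp_increasing[OF assms(2)]) (use assms minor_has_derivative minor'_pos in force)

lemma minor_mono: "0 \<le> r \<Longrightarrow> r \<le> s \<Longrightarrow> s < 1 \<Longrightarrow> minor r \<le> minor s"
  using minor_less[of r s] by (cases "r = s") auto

lemma minor_pos: "0 < r \<Longrightarrow> r < 1 \<Longrightarrow> 0 < minor r"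
  using minor_less[of 0 r] minor_0 by simp

text \<open>The logarithmic derivative \<open>(\<psi>(-r) - 1) / r\<close> is negative, because
  \<psi> increases on (-1, 1) to the value 1 at 0.\<close>

lemma minor'_less_1:
  assumes "0 < r" "r < 1"
  shows "minor' r < 1"
proof -
  have neg: "(Re (\<psi> (- of_real s)) - 1) / s < 0" if "0 < s" "s < 1" for s
    using ma_minda_strict_mono[OF mm, of "- s" 0] that psi_0 by (simp add: divide_less_0_iff)
  have "ln (minor' r) < ln (minor' 0)"
  proof (rule DERIV_neg_imp_decreasing_open[OF assms(1)])
    show "\<exists>y. ((\<lambda>r. ln (minor' r)) has_real_derivative y) (at x) \<and> y < 0" if "0 < x" "x < r" for x
      using ln_minor'_has_derivative[of x] neg[of x] that assms by auto
    show "continuous_on {0..r} (\<lambda>r. ln (minor' r))"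
      by (rule continuous_on_subset[OF continuous_ln_minor']) (use assms in auto)
  qed
  then show ?thesis using minor'_pos[of r] assms minor'_0 by simp
qed

text \<open>This is \<open>-f0(-1)\<close>: \<open>minor\<close> increases and is bounded, so its
  supremum is its limit at 1.\<close>

definition minor_end :: real where "minor_end = (SUP r\<in>{0..<1}. minor r)"

lemma minor_diff_le:
  assumes "0 \<le> r" "r < s" "s < 1"
  shows "minor s - minor r < s - r"
proof -
  obtain z where z: "r < z" "z < s" "minor s - minor r = (s - r) * minor' z"
    using MVT2[OF assms(2), of minor minor'] minor_has_derivative assms by force
  have "(s - r) * minor' z < (s - r) * 1"
    using minor'_less_1[of z] z assms by (intro mult_strict_left_mono) auto
  then show ?thesis using z by simp
qed

lemma minor_bdd: "bdd_above (minor ` {0..<1})"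
proof (rule bdd_aboveI2)
  fix r :: real assume "r \<in> {0..<1}"
  then show "minor r \<le> 1" using minor_diff_le[of 0 r] minor_0 by (cases "r = 0") auto
qed

lemma minor_le_end: "0 \<le> r \<Longrightarrow> r < 1 \<Longrightarrow> minor r \<le> minor_end"
  unfolding minor_end_def by (intro cSUP_upper minor_bdd) auto

lemma minor_less_end: "0 \<le> r \<Longrightarrow> r < 1 \<Longrightarrow> minor r < minor_end"
  using minor_less[of r "(r + 1) / 2"] minor_le_end[of "(r + 1) / 2"] by simp

text \<open>A supremum of values below 1 might still be 1; splitting at 1/2 preserves the deficit
  \<open>1/2 - minor (1/2)\<close>. The strict inequality makes \<open>minor_end\<close> a point of
  (0, 1) at which the root equation can be tested.\<close>

lemma minor_end_less_1: "minor_end < 1"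
proof -
  have "minor_end \<le> minor (1 / 2) + 1 / 2"
    unfolding minor_end_def
  proof (rule cSUP_least)
    fix r :: real assume r: "r \<in> {0..<1}"
    show "minor r \<le> minor (1 / 2) + 1 / 2"
    proof (cases "r \<le> 1 / 2")
      case True
      then have "minor r \<le> minor (1 / 2)" using minor_mono[of r "1 / 2"] r by simp
      then show ?thesis by simp
    next
      case False
      then show ?thesis using minor_diff_le[of "1 / 2" r] r by simp
    qed
  qed auto
  also have "minor (1 / 2) < 1 / 2" using minor_diff_le[of 0 "1 / 2"] minor_0 by simp
  finally show ?thesis by simp
qed

lemma minor_tendsto: "(minor \<longlongrightarrow> minor_end) (at_left 1)"
proof (rule order_tendstoI)
  fix a assume "a < minor_end"
  then obtain r where r: "0 \<le> r" "r < 1" "a < minor r"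
    unfolding minor_end_def using less_cSUP_iff[OF _ minor_bdd] by auto
  have "\<forall>\<^sub>F s in at_left 1. r < s \<and> s < 1"
    using eventually_at_left[of r 1] r by (auto intro: exI[of _ r])
  then show "\<forall>\<^sub>F s in at_left 1. a < minor s"
  proof (rule eventually_mono)
    fix s assume "r < s \<and> s < 1"
    then show "a < minor s" using minor_less[of r s] r by linarith
  qed
next
  fix a assume "minor_end < a"
  have "\<forall>\<^sub>F s in at_left 1. (0::real) < s \<and> s < 1"
    using eventually_at_left[of 0 "1::real"] by (auto intro: exI[of _ 0])
  then show "\<forall>\<^sub>F s in at_left 1. minor s < a"
  proof (rule eventually_mono)
    fix s :: real assume "0 < s \<and> s < 1"
    then show "minor s < a" using minor_le_end[of s] \<open>minor_end < a\<close> by linarith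
  qed
qed

lemma f0_tendsto: "((\<lambda>r. f0 (- of_real r)) \<longlongrightarrow> - of_real minor_end) (at_left 1)"
proof -
  have "((\<lambda>r. - complex_of_real (minor r)) \<longlongrightarrow> - of_real minor_end) (at_left 1)"
    by (intro tendsto_intros minor_tendsto)
  moreover have "\<forall>\<^sub>F r in at_left 1. - complex_of_real (minor r) = f0 (- of_real r)"
    using eventually_at_left[of 0 "1::real"] by (auto intro!: exI[of _ 0] simp: f0_minor)
  ultimately show ?thesis by (rule Lim_transform_eventually)
qed

lemma value_at_minus_one_f0: "value_at_minus_one f0 = - of_real minor_end"
  unfolding value_at_minus_one_def by (rule tendsto_Lim[OF _ f0_tendsto]) simp

lemma classC_univalent_growth:
  assumes f: "classC \<psi> f"
  shows "inj_on f (ball 0 1)" "\<And>z. z \<in> ball 0 1 \<Longrightarrow> minor (cmod z) \<le> cmod (f z)"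
proof -
  have A: "classA f" and nz: "\<And>z. z \<in> ball 0 1 \<Longrightarrow> deriv f z \<noteq> 0"
    using f by (auto simp: classC_def)
  obtain w where w: "schwarz_function w" "\<And>z. z \<in> ball 0 1 \<Longrightarrow> convexity_quotient f z = \<psi> (w z)"
    using f by (auto simp: classC_def subordinate_def)
  have pos: "0 < Re (convexity_quotient f z)" if "z \<in> ball 0 1" for z
    using mm w that by (fastforce simp: schwarz_function_def ma_minda_def)
  obtain q where q: "q holomorphic_on ball 0 1" "q 0 = 1" "\<And>z. z \<in> ball 0 1 \<Longrightarrow> f z = z * q z"
    "\<And>z. z \<in> ball 0 1 \<Longrightarrow> q z \<noteq> 0" "\<And>z. z \<in> ball 0 1 \<Longrightarrow> 0 < Re (deriv f z / q z)"
    using convex_imp_starlike[OF A nz pos] by metis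
  show "inj_on f (ball 0 1)" by (rule starlike_inj_on[OF q])
  show "minor (cmod z) \<le> cmod (f z)" if "z \<in> ball 0 1" for z
    by (rule starlike_growth[OF q, of minor minor'])
       (use minor_0 minor'_0 minor_has_derivative minor_pos classC_deriv_lower_bound[OF f] that in auto)
qed

lemma classC_boundary_dist:
  assumes f: "classC \<psi> f"
  shows "minor_end \<le> boundary_dist f"
proof -
  have h: "f holomorphic_on ball 0 1" "f 0 = 0" using f by (auto simp: classC_def classA_def)
  show ?thesis
    by (rule le_boundary_dist[OF h classC_univalent_growth(1)[OF f] classC_univalent_growth(2)[OF f] minor_mono minor_tendsto])
qed

text \<open>The limit \<open>f0(-1)\<close> is a frontier point at distance
  \<open>minor_end\<close>: it lies in the closure of the image but is not a value, since by
  symmetry and univalence a preimage would be real, and on (-1, 1) \<open>minor\<close> stays below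
  \<open>minor_end\<close>.\<close>

lemma boundary_dist_f0: "boundary_dist f0 = minor_end"
proof (rule antisym)
  let ?D = "f0 ` ball 0 1" and ?y = "- complex_of_real minor_end"
  have "?y \<in> closure ?D"
  proof (rule Lim_in_closed_set[OF closed_closure _ _ f0_tendsto])
    have "f0 (- of_real r) \<in> closure ?D" if "0 < r" "r < 1" for r :: real
      using that by (intro closure_subset[THEN subsetD] imageI) auto
    then show "\<forall>\<^sub>F r in at_left (1::real). f0 (- of_real r) \<in> closure ?D"
      using eventually_at_left[of 0 "1::real"] by (auto intro!: exI[of _ 0])
  qed simp
  moreover have "?y \<notin> ?D"
  proof
    assume "?y \<in> ?D"
    then obtain z where z: "z \<in> ball 0 1" "f0 z = ?y" by auto
    have "f0 (cnj z) = f0 z"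
      using real_coeff_imp_cnj_symmetric[OF f0_holomorphic f0_real_coeff z(1)] z(2) by simp
    then have "cnj z = z"
      using classC_univalent_growth(1)[OF f0_classC] z(1) by (auto simp: inj_on_def)
    then have zr: "z = of_real (Re z)" by (metis Reals_cnj_iff of_real_Re)
    define r where "r = - Re z"
    have r: "\<bar>r\<bar> < 1" "z = - of_real r" using z(1) zr abs_Re_le_cmod[of z] by (auto simp: r_def)
    then have "minor r = minor_end" using z(2) f0_minor[of r] by simp
    moreover have "minor r < minor_end"
    proof (cases "0 \<le> r")
      case True
      then show ?thesis using minor_less_end r by simp
    next
      case False
      have "minor r < minor 0"
        by (rule DERIV_pos_imp_increasing) (use False r minor_has_derivative minor'_pos in force)+
      then show ?thesis using minor_less_end[of 0] by simp
    qed
    ultimately show False by simp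
  qed
  ultimately have "?y \<in> frontier ?D"
    using open_mapping_thm3[OF f0_holomorphic open_ball classC_univalent_growth(1)[OF f0_classC]]
    by (simp add: frontier_def interior_open)
  then have "boundary_dist f0 \<le> dist (f0 0) ?y"
    unfolding boundary_dist_def by (rule infdist_le)
  then show "boundary_dist f0 \<le> minor_end"
    using minor_less_end[of 0] minor_0 by (simp add: f0_0)
qed (rule classC_boundary_dist[OF f0_classC])

end

section \<open>Majorant bounds for power series\<close>

text \<open>Bounding all partial sums, rather than the sum of the series, keeps the calculus of
  majorants within finite sums; summability then follows by \<open>fps_bound_suminf\<close>.\<close>

definition fps_bound :: "real \<Rightarrow> complex fps \<Rightarrow> real \<Rightarrow> bool" where
  "fps_bound t A c \<longleftrightarrow> (\<forall>N. (\<Sum>n\<le>N. cmod (fps_nth A n) * t ^ n) \<le> c)"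

lemma fps_bound_mono: "fps_bound t A c \<Longrightarrow> c \<le> d \<Longrightarrow> fps_bound t A d"
  unfolding fps_bound_def using order_trans by blast

lemma fps_bound_nonneg: "fps_bound t A c \<Longrightarrow> 0 \<le> c"
  unfolding fps_bound_def by (drule spec[of _ 0]) (auto intro: order_trans[OF norm_ge_zero])

lemma fps_bound_suminf:
  assumes "fps_bound t A c" "0 \<le> t"
  shows "summable (\<lambda>n. cmod (fps_nth A n) * t ^ n)" "(\<Sum>n. cmod (fps_nth A n) * t ^ n) \<le> c"
proof -
  have *: "(\<Sum>n<N. cmod (fps_nth A n) * t ^ n) \<le> c" for N
    using assms(1) fps_bound_nonneg[OF assms(1)]
    by (cases N) (auto simp: fps_bound_def lessThan_Suc_atMost)
  show "summable (\<lambda>n. cmod (fps_nth A n) * t ^ n)"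
    by (rule summableI_nonneg_bounded[OF _ *]) (use assms(2) in auto)
  then show "(\<Sum>n. cmod (fps_nth A n) * t ^ n) \<le> c"
    by (rule suminf_le_const) (rule *)
qed

lemma fps_bound_of_summable:
  assumes "summable (\<lambda>n. cmod (fps_nth A n) * t ^ n)" "0 \<le> t"
  shows "fps_bound t A (\<Sum>n. cmod (fps_nth A n) * t ^ n)"
  unfolding fps_bound_def using assms by (intro allI sum_le_suminf) auto

lemma fps_bound_add:
  assumes "fps_bound t A a" "fps_bound t B b" "0 \<le> t"
  shows "fps_bound t (A + B) (a + b)"
  unfolding fps_bound_def
proof
  fix N
  have "(\<Sum>n\<le>N. cmod (fps_nth (A + B) n) * t ^ n)
      \<le> (\<Sum>n\<le>N. cmod (fps_nth A n) * t ^ n + cmod (fps_nth B n) * t ^ n)"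
    using \<open>0 \<le> t\<close> by (intro sum_mono) (simp add: norm_triangle_ineq mult_right_mono flip: distrib_right)
  also have "\<dots> \<le> a + b"
    using assms unfolding sum.distrib fps_bound_def by (intro add_mono) auto
  finally show "(\<Sum>n\<le>N. cmod (fps_nth (A + B) n) * t ^ n) \<le> a + b" .
qed

lemma fps_bound_mult:
  assumes A: "fps_bound t A a" and B: "fps_bound t B b" and t: "0 \<le> t"
  shows "fps_bound t (A * B) (a * b)"
  unfolding fps_bound_def
proof
  fix N
  define f g where "f i = cmod (fps_nth A i) * t ^ i" and "g i = cmod (fps_nth B i) * t ^ i" for i
  have fg: "0 \<le> f i" "0 \<le> g i" for i using t by (auto simp: f_def g_def)
  have "(\<Sum>n\<le>N. cmod (fps_nth (A * B) n) * t ^ n) \<le> (\<Sum>n\<le>N. \<Sum>i\<le>n. f i * g (n - i))"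
  proof (rule sum_mono)
    fix n
    have "cmod (fps_nth (A * B) n) \<le> (\<Sum>i\<le>n. cmod (fps_nth A i) * cmod (fps_nth B (n - i)))"
      unfolding fps_mult_nth atLeast0AtMost norm_mult[symmetric] by (rule norm_sum)
    then have "cmod (fps_nth (A * B) n) * t ^ n
        \<le> (\<Sum>i\<le>n. cmod (fps_nth A i) * cmod (fps_nth B (n - i))) * t ^ n"
      using t by (intro mult_right_mono) auto
    also have "\<dots> = (\<Sum>i\<le>n. f i * g (n - i))"
      unfolding sum_distrib_right
      by (rule sum.cong) (auto simp: f_def g_def power_add[symmetric] mult_ac)
    finally show "cmod (fps_nth (A * B) n) * t ^ n \<le> (\<Sum>i\<le>n. f i * g (n - i))" .
  qed
  also have "\<dots> = (\<Sum>(i, j)\<in>{(i, j). i + j \<le> N}. f i * g j)"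
    by (rule sum.triangle_reindex_eq[symmetric])
  also have "\<dots> \<le> (\<Sum>(i, j)\<in>{..N} \<times> {..N}. f i * g j)"
    using fg by (intro sum_mono2) auto
  also have "\<dots> = (\<Sum>i\<le>N. f i) * (\<Sum>j\<le>N. g j)"
    by (simp add: sum_product sum.cartesian_product)
  also have "\<dots> \<le> a * b"
    using A B fg fps_bound_nonneg[OF A] unfolding fps_bound_def f_def g_def
    by (intro mult_mono) (auto intro: sum_nonneg)
  finally show "(\<Sum>n\<le>N. cmod (fps_nth (A * B) n) * t ^ n) \<le> a * b" .
qed

lemma fps_bound_const: "fps_bound t (fps_const c) (cmod c)"
  unfolding fps_bound_def
proof
  fix N
  have "(\<Sum>n\<le>N. cmod (fps_nth (fps_const c) n) * t ^ n) = (\<Sum>n\<le>N. if n = 0 then cmod c else 0)"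
    by (rule sum.cong) auto
  then show "(\<Sum>n\<le>N. cmod (fps_nth (fps_const c) n) * t ^ n) \<le> cmod c" by simp
qed

lemma fps_bound_X:
  assumes "0 \<le> t"
  shows "fps_bound t fps_X t"
  unfolding fps_bound_def
proof
  fix N
  have "(\<Sum>n\<le>N. cmod (fps_nth fps_X n) * t ^ n) = (\<Sum>n\<le>N. if n = 1 then t else 0)"
    by (rule sum.cong) auto
  then show "(\<Sum>n\<le>N. cmod (fps_nth fps_X n) * t ^ n) \<le> t" using assms by simp
qed

lemma fps_bound_power:
  assumes "fps_bound t A a" "0 \<le> t"
  shows "fps_bound t (A ^ n) (a ^ n)"
  by (induction n) (use fps_bound_const[of t 1] in \<open>auto intro: fps_bound_mult assms\<close>)

text \<open>Covers compositions, with \<open>P i = W ^ i\<close>, as well as differences of two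
  compositions, with \<open>P i = W ^ i - U ^ i\<close>.\<close>

lemma fps_bound_series:
  assumes nth: "\<And>n. fps_nth A n = (\<Sum>i\<le>n. fps_nth F i * fps_nth (P i) n)"
    and P: "\<And>i. fps_bound t (P i) (b i)" and t: "0 \<le> t"
    and d: "\<And>N. (\<Sum>i\<le>N. cmod (fps_nth F i) * b i) \<le> d"
  shows "fps_bound t A d"
  unfolding fps_bound_def
proof
  fix N
  have "(\<Sum>n\<le>N. cmod (fps_nth A n) * t ^ n)
      \<le> (\<Sum>n\<le>N. \<Sum>i\<le>N. cmod (fps_nth F i) * (cmod (fps_nth (P i) n) * t ^ n))"
  proof (rule sum_mono)
    fix n assume n: "n \<in> {..N}"
    have "cmod (fps_nth A n) \<le> (\<Sum>i\<le>n. cmod (fps_nth F i) * cmod (fps_nth (P i) n))"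
      unfolding nth norm_mult[symmetric] by (rule norm_sum)
    also have "\<dots> \<le> (\<Sum>i\<le>N. cmod (fps_nth F i) * cmod (fps_nth (P i) n))"
      using n by (intro sum_mono2) auto
    finally have "cmod (fps_nth A n) * t ^ n \<le> (\<Sum>i\<le>N. cmod (fps_nth F i) * cmod (fps_nth (P i) n)) * t ^ n"
      using t by (intro mult_right_mono) auto
    then show "cmod (fps_nth A n) * t ^ n \<le> (\<Sum>i\<le>N. cmod (fps_nth F i) * (cmod (fps_nth (P i) n) * t ^ n))"
      by (simp add: sum_distrib_right mult.assoc)
  qed
  also have "\<dots> = (\<Sum>i\<le>N. cmod (fps_nth F i) * (\<Sum>n\<le>N. cmod (fps_nth (P i) n) * t ^ n))"
    unfolding sum_distrib_left by (rule sum.swap)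
  also have "\<dots> \<le> (\<Sum>i\<le>N. cmod (fps_nth F i) * b i)"
    using P unfolding fps_bound_def by (intro sum_mono mult_left_mono) auto
  also have "\<dots> \<le> d" by (rule d)
  finally show "(\<Sum>n\<le>N. cmod (fps_nth A n) * t ^ n) \<le> d" .
qed

lemma fps_bound_compose:
  assumes "fps_bound t W c" "0 \<le> t" "\<And>N. (\<Sum>i\<le>N. cmod (fps_nth F i) * c ^ i) \<le> d"
  shows "fps_bound t (F oo W) d"
  by (rule fps_bound_series[where P = "\<lambda>i. W ^ i" and F = F])
     (use assms in \<open>auto simp: fps_compose_nth atLeast0AtMost intro: fps_bound_power\<close>)

lemma fps_bound_exp:
  assumes "fps_bound t E e" "0 \<le> t"
  shows "fps_bound t (fps_exp 1 oo E) (exp e)"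
proof (rule fps_bound_compose[OF assms])
  fix N
  have "(\<Sum>i\<le>N. e ^ i /\<^sub>R fact i) \<le> (\<Sum>i. e ^ i /\<^sub>R fact i)"
    using fps_bound_nonneg[OF assms(1)] by (intro sum_le_suminf summable_exp_generic) auto
  then show "(\<Sum>i\<le>N. cmod (fps_nth (fps_exp 1) i) * e ^ i) \<le> exp e"
    by (simp add: exp_def norm_divide field_simps)
qed

text \<open>Telescoping, as for the derivative of a power. At \<open>i = 0\<close> the truncated
  exponent is harmless because of the factor \<open>real i\<close>.\<close>

lemma fps_bound_power_diff:
  assumes W: "fps_bound t W t" and U: "fps_bound t U t" and Y: "fps_bound t (W - U) c" and t: "0 \<le> t"
  shows "fps_bound t (W ^ i - U ^ i) (real i * t ^ (i - 1) * c)"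
proof (induction i)
  case 0
  then show ?case by (simp add: fps_bound_def)
next
  case (Suc i)
  have "W ^ Suc i - U ^ Suc i = W * (W ^ i - U ^ i) + (W - U) * U ^ i"
    by (simp add: algebra_simps)
  moreover have "fps_bound t (W * (W ^ i - U ^ i) + (W - U) * U ^ i)
      (t * (real i * t ^ (i - 1) * c) + c * t ^ i)"
    by (intro fps_bound_add fps_bound_mult fps_bound_power Suc W U Y t)
  moreover have "t * (real i * t ^ (i - 1) * c) + c * t ^ i = real (Suc i) * t ^ (Suc i - 1) * c"
    by (cases i) (auto simp: algebra_simps)
  ultimately show ?case by simp
qed

text \<open>A partial sum of the majorant of \<open>E\<close> is a polynomial \<open>e\<close> with
  \<open>e 0 = 0\<close>, and \<open>s e'(s)\<close> is the partial sum for
  \<open>fps_X * fps_deriv E\<close>. Hence \<open>H - e\<close> does not decrease.\<close>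

lemma fps_bound_integrate:
  assumes D: "\<And>s. 0 < s \<Longrightarrow> s < t \<Longrightarrow> fps_bound s (fps_X * fps_deriv E) (s * H' s)"
    and E0: "fps_nth E 0 = 0" and t: "0 \<le> t"
    and H: "\<And>s. 0 \<le> s \<Longrightarrow> s \<le> t \<Longrightarrow> (H has_real_derivative H' s) (at s)" and H0: "H 0 = 0"
  shows "fps_bound t E (H t)"
  unfolding fps_bound_def
proof
  fix N
  define e where "e s = (\<Sum>n\<le>N. cmod (fps_nth E n) * s ^ n)" for s
  define e' where "e' s = (\<Sum>n\<le>N. cmod (fps_nth E n) * (real n * s ^ (n - 1)))" for s
  have de: "(e has_real_derivative e' s) (at s)" for s
    unfolding e_def e'_def by (auto intro!: derivative_eq_intros simp: mult_ac)
  have "H 0 - e 0 \<le> H t - e t"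
  proof (rule DERIV_nonneg_imp_increasing_open[OF t])
    fix s assume s: "0 < s" "s < t"
    have "s * e' s = (\<Sum>n\<le>N. cmod (fps_nth (fps_X * fps_deriv E) n) * s ^ n)"
    proof -
      have "s * (cmod (fps_nth E n) * (real n * s ^ (n - 1)))
          = cmod (fps_nth (fps_X * fps_deriv E) n) * s ^ n" for n
        by (cases n) (simp_all add: norm_mult mult_ac del: of_nat_Suc)
      then show ?thesis unfolding e'_def sum_distrib_left by (simp only:)
    qed
    also have "\<dots> \<le> s * H' s" using D[OF s] unfolding fps_bound_def by blast
    finally have "e' s \<le> H' s" using s by simp
    then show "\<exists>y. ((\<lambda>s. H s - e s) has_real_derivative y) (at s) \<and> 0 \<le> y"
      using s by (intro exI[of _ "H' s - e' s"] conjI DERIV_diff de H) auto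
  next
    have "continuous_on {0..t} H"
      using H by (intro DERIV_continuous_on[of _ _ H']) (auto intro: has_field_derivative_at_within)
    moreover have "continuous_on {0..t} e"
      using de by (intro DERIV_continuous_on[of _ _ e']) (auto intro: has_field_derivative_at_within)
    ultimately show "continuous_on {0..t} (\<lambda>s. H s - e s)" by (intro continuous_intros)
  qed
  moreover have "e 0 = 0" unfolding e_def using E0 by (intro sum.neutral) (auto simp: power_0_left)
  ultimately show "(\<Sum>n\<le>N. cmod (fps_nth E n) * t ^ n) \<le> H t" using H0 by (simp add: e_def)
qed

text \<open>The right-hand side is the value of the full series; the induction carries the exact
  remainder, whose sign gives the bound.\<close>

lemma sum_squares_power_le:
  fixes t :: real
  assumes t: "0 \<le> t" "t < 1"
  shows "(\<Sum>i<N. (real i + 1)\<^sup>2 * t ^ i) \<le> (1 + t) / (1 - t) ^ 3"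
proof -
  have "(1 - t) ^ 3 * (\<Sum>i<N. (real i + 1)\<^sup>2 * t ^ i)
     = 1 + t - t ^ N * ((real N * (1 - t) + 1)\<^sup>2 + t)"
  proof (induction N)
    case (Suc N)
    then show ?case
      by (simp add: algebra_simps power2_eq_square power3_eq_cube)
  qed (simp add: power2_eq_square)
  also have "\<dots> \<le> 1 + t" using t by simp
  finally show ?thesis using t by (simp add: field_simps)
qed

lemma sum_geometric_le:
  fixes t :: real
  assumes "0 \<le> t" "t < 1"
  shows "(\<Sum>n<N. t ^ n) \<le> 1 / (1 - t)"
  using assms sum_le_suminf[of "\<lambda>n. t ^ n" "{..<N}"] by (simp add: summable_geometric suminf_geometric)

text \<open>\<open>hat\<close> presupposes the normalisation of \<open>classA\<close>. This version
  also applies to derivatives and to the co-analytic part, and the derivative of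
  \<open>maj f\<close> is \<open>maj (deriv f)\<close>.\<close>

definition maj :: "(complex \<Rightarrow> complex) \<Rightarrow> real \<Rightarrow> real" where
  "maj f t = (\<Sum>n. cmod (taylor_coeff f n) * t ^ n)"

lemma maj_summable:
  assumes "f holomorphic_on ball 0 1" "\<bar>t\<bar> < 1"
  shows "summable (\<lambda>n. cmod (taylor_coeff f n) * t ^ n)"
proof -
  have "fps_conv_radius (fps_expansion f 0) \<ge> 1"
    using assms(1) conv_radius_fps_expansion[of f 0 "ereal 1"] by (simp add: one_ereal_def)
  then have "summable (\<lambda>n. norm (fps_nth (fps_expansion f 0) n * of_real t ^ n))"
    using assms(2) by (intro abs_summable_in_conv_radius)
      (auto simp: fps_conv_radius_def elim!: order.strict_trans2[rotated])
  then have "summable (\<lambda>n. norm (cmod (taylor_coeff f n) * t ^ n))"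
    by (simp add: taylor_coeff_def norm_mult norm_power abs_mult power_abs)
  then show ?thesis by (rule summable_norm_cancel)
qed

lemma maj_fps_bound:
  assumes "f holomorphic_on ball 0 1" "0 \<le> t" "t < 1"
  shows "fps_bound t (fps_expansion f 0) (maj f t)"
  using fps_bound_of_summable[of "fps_expansion f 0" t] maj_summable[OF assms(1), of t] assms(2,3)
  by (simp add: maj_def taylor_coeff_def)

lemma fps_bound_maj:
  assumes "fps_bound t (fps_expansion f 0) c" "0 \<le> t"
  shows "maj f t \<le> c"
  using fps_bound_suminf(2)[OF assms] by (simp add: maj_def taylor_coeff_def)

lemma maj_has_derivative:
  assumes holo: "f holomorphic_on ball 0 1" and t: "\<bar>t\<bar> < 1"
  shows "(maj f has_real_derivative maj (deriv f) t) (at t)"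
proof -
  define K where "K = (\<bar>t\<bar> + 1) / 2"
  have K: "\<bar>t\<bar> < K" "\<bar>K\<bar> < 1" "0 < K" using t by (auto simp: K_def)
  have "((\<lambda>t. \<Sum>n. cmod (taylor_coeff f n) * t ^ n) has_real_derivative
      (\<Sum>n. diffs (\<lambda>n. cmod (taylor_coeff f n)) n * t ^ n)) (at t)"
    by (rule termdiffs_strong[OF maj_summable[OF holo K(2)]]) (use K in auto)
  moreover have "diffs (\<lambda>n. cmod (taylor_coeff f n)) n = cmod (taylor_coeff (deriv f) n)" for n
    by (simp add: diffs_def taylor_coeff_deriv_fun norm_mult del: of_nat_Suc)
  ultimately show ?thesis by (simp add: maj_def[abs_def])
qed

lemma maj_0: "maj f 0 = cmod (f 0)"
  unfolding maj_def by (subst suminf_finite[of "{0}"]) auto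

lemma bounded_tail_fps_bound:
  assumes holo: "f holomorphic_on ball 0 1" and bd: "\<And>z. z \<in> ball 0 1 \<Longrightarrow> cmod (f z) \<le> k"
    and t: "0 \<le> t" "t < 1"
  shows "fps_bound t (fps_expansion f 0 - fps_const (f 0)) (2 * (k - cmod (f 0)) * t / (1 - t))"
  unfolding fps_bound_def
proof
  fix N
  let ?A = "fps_expansion f 0 - fps_const (f 0)"
  have a: "cmod (f 0) \<le> k" using bd[of 0] by simp
  have "fps_nth (fps_expansion f 0) 0 = f 0" using taylor_coeff_0[of f] by (simp add: taylor_coeff_def)
  then have "(\<Sum>n\<le>N. cmod (fps_nth ?A n) * t ^ n) = (\<Sum>n<N. cmod (taylor_coeff f (Suc n)) * t ^ Suc n)"
    unfolding lessThan_Suc_atMost[symmetric] sum.lessThan_Suc_shift by (simp add: taylor_coeff_def)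
  also have "\<dots> \<le> (\<Sum>n<N. 2 * (k - cmod (f 0)) * t ^ Suc n)"
    using bounded_coeff[OF holo bd] t by (intro sum_mono mult_right_mono) auto
  also have "\<dots> = 2 * (k - cmod (f 0)) * t * (\<Sum>n<N. t ^ n)"
    unfolding sum_distrib_left by (rule sum.cong) auto
  also have "\<dots> \<le> 2 * (k - cmod (f 0)) * t * (1 / (1 - t))"
    using t a by (intro mult_left_mono sum_geometric_le) auto
  finally show "(\<Sum>n\<le>N. cmod (fps_nth ?A n) * t ^ n) \<le> 2 * (k - cmod (f 0)) * t / (1 - t)"
    by simp
qed

text \<open>Bohr's theorem: the tail is at most \<open>(k - |f 0|) 2 t / (1 - t)\<close>, and
  \<open>2 t / (1 - t)\<close> reaches 1 at \<open>t = 1/3\<close>.\<close>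

lemma bohr_bounded:
  assumes holo: "f holomorphic_on ball 0 1" and bd: "\<And>z. z \<in> ball 0 1 \<Longrightarrow> cmod (f z) \<le> k"
    and t: "0 \<le> t" "t \<le> 1 / 3"
  shows "fps_bound t (fps_expansion f 0) k"
proof -
  have a: "cmod (f 0) \<le> k" using bd[of 0] by simp
  have "fps_bound t (fps_const (f 0) + (fps_expansion f 0 - fps_const (f 0)))
      (cmod (f 0) + 2 * (k - cmod (f 0)) * t / (1 - t))"
    by (intro fps_bound_add fps_bound_const bounded_tail_fps_bound) (use holo bd t in auto)
  then have "fps_bound t (fps_expansion f 0) (cmod (f 0) + 2 * (k - cmod (f 0)) * t / (1 - t))" by simp
  moreover have "(k - cmod (f 0)) * (2 * t / (1 - t)) \<le> (k - cmod (f 0)) * 1"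
    using t a by (intro mult_left_mono) (auto simp: field_simps)
  then have "2 * (k - cmod (f 0)) * t / (1 - t) \<le> k - cmod (f 0)"
    by (simp only: mult.commute[of 2] mult.assoc times_divide_eq_right mult_1_right)
  then have "cmod (f 0) + 2 * (k - cmod (f 0)) * t / (1 - t) \<le> k" by (simp only: le_diff_eq add.commute)
  ultimately show ?thesis by (rule fps_bound_mono)
qed

text \<open>With \<open>p\<close> the cubic, \<open>p(y) exp(-y)\<close> has derivative
  \<open>exp(-y) y^2 (41 - 47 y) / 200\<close>, nonnegative up to 41/47, which exceeds 87/100. The
  exponents to which the bound is applied are at most 5/6.\<close>

lemma exp_cubic_bound:
  fixes y :: real
  assumes "0 \<le> y" "y \<le> 87 / 100"
  shows "exp y \<le> 1 + y + y\<^sup>2 / 2 + (47 / 200) * y ^ 3"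
proof -
  let ?p = "\<lambda>y::real. 1 + y + y\<^sup>2 / 2 + (47 / 200) * y ^ 3"
  have "?p 0 * exp (- 0) \<le> ?p y * exp (- y)"
  proof (rule DERIV_nonneg_imp_nondecreasing[OF assms(1)])
    fix s assume s: "0 \<le> s" "s \<le> y"
    have "((\<lambda>y. ?p y * exp (- y)) has_real_derivative
        (1 + s + (141 / 200) * s\<^sup>2) * exp (- s) - ?p s * exp (- s)) (at s)"
      by (auto intro!: derivative_eq_intros simp: field_simps power2_eq_square power3_eq_cube)
    moreover have "(1 + s + (141 / 200) * s\<^sup>2) * exp (- s) - ?p s * exp (- s)
        = exp (- s) * (s\<^sup>2 * ((41 / 200) - (47 / 200) * s))"
      by (simp add: algebra_simps power2_eq_square power3_eq_cube)
    moreover have "0 \<le> exp (- s) * (s\<^sup>2 * ((41 / 200) - (47 / 200) * s))"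
      using s assms by (intro mult_nonneg_nonneg) auto
    ultimately show "\<exists>z. ((\<lambda>y. ?p y * exp (- y)) has_real_derivative z) (at s) \<and> 0 \<le> z"
      by (intro exI conjI) simp_all
  qed
  then show ?thesis by (simp add: exp_minus field_simps)
qed

section \<open>Comparison of majorants\<close>

text \<open>The cubic factor in the last bound truncates the power series of
  \<open>(3 + t) (1 + 2 t) / (6 (1 - t)^3)\<close>; the coefficient 27 absorbs its tail for \<open>t \<le> 1/3\<close>.\<close>

lemma exponent_bounds:
  fixes t :: real
  assumes t: "0 \<le> t" "t \<le> 1 / 3"
  defines "S \<equiv> t\<^sup>2 * (3 + t) / (6 * (1 - t) ^ 3)"
  shows "0 \<le> S" "S \<le> 5 / 24" "S * (1 + 2 * t) \<le> 25 / 24 * t"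
    "S * (1 + 2 * t) \<le> t\<^sup>2 * (1 / 2 + 8 / 3 * t + 41 / 6 * t\<^sup>2 + 27 * t ^ 3)"
proof -
  have d: "8 / 27 \<le> (1 - t) ^ 3"
    using power_mono[of "2 / 3" "1 - t" 3] t by (simp add: power3_eq_cube)
  show S0: "0 \<le> S" unfolding S_def using t by simp
  have "t\<^sup>2 * (3 + t) / (6 * (1 - t) ^ 3) \<le> t\<^sup>2 * (10 / 3) / (6 * (8 / 27))"
    using t d by (intro frac_le mult_left_mono mult_nonneg_nonneg) auto
  then have S: "S \<le> 15 / 8 * t\<^sup>2" by (simp add: S_def)
  have t2: "t\<^sup>2 \<le> t * (1 / 3)" "t\<^sup>2 \<le> (1 / 3)\<^sup>2"
    using mult_left_mono[of t "1 / 3" t] power_mono[of t "1 / 3" 2] t by (simp_all add: power2_eq_square)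
  then show "S \<le> 5 / 24" using S by (simp add: power2_eq_square)
  have "S * (1 + 2 * t) \<le> (15 / 8 * t\<^sup>2) * (5 / 3)"
    using S t by (intro mult_mono) auto
  then show "S * (1 + 2 * t) \<le> 25 / 24 * t" using t2 by simp
  \<comment> \<open>After multiplication by \<open>6 (1 - t)^3\<close> the two sides of the last
    bound differ by \<open>t^3\<close> times a cubic with lowest coefficients 84 and -379. Replacing
    \<open>t^3\<close> by \<open>t^2 / 3\<close> in it leaves this quadratic, and subtracting the
    square leaves a linear function that is positive at 1/3.\<close>
  have "0 \<le> 391 * (t - 1 / 3)\<^sup>2" by simp
  then have "0 \<le> 84 - 379 * t + 391 * t\<^sup>2" using t by (simp add: power2_eq_square algebra_simps)
  moreover have "t ^ 3 \<le> t\<^sup>2 * (1 / 3)" using mult_left_mono[of t "1 / 3" "t\<^sup>2"] t by (simp add: power3_eq_cube power2_eq_square)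
  ultimately have "0 \<le> t ^ 3 * (84 - 379 * t + 445 * t\<^sup>2 - 162 * t ^ 3)"
    using t by (intro mult_nonneg_nonneg) auto
  then have "(3 + t) * (1 + 2 * t) \<le> (3 + 16 * t + 41 * t\<^sup>2 + 162 * t ^ 3) * (1 - t) ^ 3"
    by (simp add: algebra_simps power2_eq_square power3_eq_cube)
  also have "\<dots> = (1 / 2 + 8 / 3 * t + 41 / 6 * t\<^sup>2 + 27 * t ^ 3) * (6 * (1 - t) ^ 3)"
    unfolding mult.assoc[symmetric] by simp
  finally have "(3 + t) * (1 + 2 * t) \<le> (1 / 2 + 8 / 3 * t + 41 / 6 * t\<^sup>2 + 27 * t ^ 3) * (6 * (1 - t) ^ 3)" .
  then have "(3 + t) * (1 + 2 * t) / (6 * (1 - t) ^ 3) \<le> 1 / 2 + 8 / 3 * t + 41 / 6 * t\<^sup>2 + 27 * t ^ 3"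
    by (subst pos_divide_le_eq) (use d t in simp_all)
  from mult_left_mono[OF this, of "t\<^sup>2"]
  show "S * (1 + 2 * t) \<le> t\<^sup>2 * (1 / 2 + 8 / 3 * t + 41 / 6 * t\<^sup>2 + 27 * t ^ 3)"
    by (simp add: S_def)
qed

text \<open>To first order in \<open>\<eta>\<close> the bound would hold with 2 in place of \<open>51/25\<close>; the margin absorbs the
  higher order terms of the exponential and is small enough for the integrated estimate below.\<close>

lemma low_order_terms_bound:
  fixes t p \<eta> S :: real
  assumes t: "0 \<le> t" "t \<le> 1 / 3" and p: "0 \<le> p" "p \<le> 2" and \<eta>: "0 \<le> \<eta>" "\<eta> \<le> 1"
    and S: "0 \<le> S" "S \<le> 5 / 24" "S * (1 + 2 * t) \<le> 25 / 24 * t"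
  defines "y \<equiv> 2 * \<eta> * p * S"
  shows "(exp y - 1) + p * t * ((1 - \<eta>) * exp y - 1) \<le> \<eta> * p * (51 / 25 * (S * (1 + p * t)) - t)"
    "(1 - \<eta>) * exp y \<le> 1"
proof -
  have y0: "0 \<le> y" using p \<eta> S by (simp add: y_def)
  have pS: "p * S \<le> 2 * (5 / 24)" using p S by (intro mult_mono) auto
  have "y = 2 * \<eta> * (p * S)" by (simp add: y_def)
  also have "\<dots> \<le> 2 * \<eta> * (5 / 12)" using pS \<eta> by (intro mult_left_mono) auto
  finally have y\<eta>: "y \<le> 5 / 6 * \<eta>" by simp
  then have y1: "y \<le> 87 / 100" using \<eta> by simp
  have "1 - \<eta> \<le> exp (- \<eta>)" using exp_ge_add_one_self[of "- \<eta>"] by simp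
  then have "(1 - \<eta>) * exp y \<le> exp (- \<eta>) * exp y" by simp
  also have "\<dots> = exp (y - \<eta>)" by (simp add: exp_diff exp_minus field_simps)
  also have "\<dots> \<le> 1" using y\<eta> \<eta> by simp
  finally show "(1 - \<eta>) * exp y \<le> 1" .
  define x where "x = exp y - 1"
  have x: "y + y\<^sup>2 / 2 \<le> x" "x \<le> y + y\<^sup>2 / 2 + 47 / 200 * y ^ 3"
    using exp_lower_Taylor_quadratic[OF y0] exp_cubic_bound[OF y0 y1] by (auto simp: x_def)
  define u where "u = \<eta> * (p * t)"
  have pt: "0 \<le> p * t" "p * t \<le> 2 / 3"
    using mult_mono[of p 2 t "1 / 3"] p t by auto
  have u: "0 \<le> u" "u \<le> p * t" using \<eta> pt by (auto simp: u_def mult_left_le_one_le)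
  have "S * (1 + p * t) \<le> S * (1 + 2 * t)" using S p t by (intro mult_left_mono add_left_mono mult_right_mono) auto
  then have "S * (1 + p * t) \<le> 25 / 24 * t" using S by linarith
  then have "\<eta> * p * (S * (1 + p * t)) \<le> \<eta> * p * (25 / 24 * t)"
    using \<eta> p by (intro mult_left_mono) auto
  then have yu: "y / 2 * (1 + p * t) \<le> 25 / 24 * u" by (simp add: y_def u_def mult_ac)
  \<comment> \<open>As \<open>51/50 * y\<close> is \<open>51/25 * \<eta> p S\<close>, the claim
    amounts to \<open>(1 + p t) (x - 51/50 y) \<le> u x\<close>. The cubic bound is used for
    \<open>x\<close> on the left, the quadratic Taylor bound on the right.\<close>
  have "(1 + p * t) * (x - 51 / 50 * y) \<le> (1 + p * t) * (y\<^sup>2 / 2 + 47 / 200 * y ^ 3 - 1 / 50 * y)"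
    using x pt by (intro mult_left_mono) auto
  also have "\<dots> = y * ((y / 2 * (1 + p * t)) * (1 + 47 / 100 * y) - 1 / 50 * (1 + p * t))"
    by (simp add: field_simps power2_eq_square power3_eq_cube)
  also have "\<dots> \<le> y * (25 / 24 * u * (1 + 47 / 100 * y) - 1 / 50 * (1 + p * t))"
    using yu y0 by (intro mult_left_mono diff_right_mono mult_right_mono) auto
  also have "\<dots> \<le> y * (u * (1 + y / 2))"
  proof (rule mult_left_mono[OF _ y0])
    \<comment> \<open>Here the margin is spent: the excess \<open>u / 24\<close> is at most
      \<open>(1 + p t) / 50\<close> because \<open>u \<le> p t \<le> 2/3\<close>, and 1175/2400,
      that is 25/24 times 47/100, stays below 1/2.\<close>
    have "25 / 24 * u + 1175 / 2400 * x - 1 / 50 * (1 + p * t) \<le> u + 1 / 2 * x" if "0 \<le> x" for x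
      using that u pt by (simp add: field_simps)
    from this[of "u * y"] show "25 / 24 * u * (1 + 47 / 100 * y) - 1 / 50 * (1 + p * t) \<le> u * (1 + y / 2)"
      using u y0 by (simp add: algebra_simps)
  qed
  also have "\<dots> = u * (y + y\<^sup>2 / 2)" by (simp add: algebra_simps power2_eq_square)
  also have "\<dots> \<le> u * x" using x u by (intro mult_left_mono) auto
  finally have "(1 + p * t) * x - 51 / 50 * y * (1 + p * t) \<le> u * x" by (simp add: algebra_simps)
  moreover have "(exp y - 1) + p * t * ((1 - \<eta>) * exp y - 1) = (1 + p * t) * x - u * x - u"
    by (simp add: x_def u_def algebra_simps)
  moreover have "\<eta> * p * (51 / 25 * (S * (1 + p * t)) - t) = 51 / 50 * y * (1 + p * t) - u"
    by (simp add: y_def u_def algebra_simps)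
  ultimately show "(exp y - 1) + p * t * ((1 - \<eta>) * exp y - 1) \<le> \<eta> * p * (51 / 25 * (S * (1 + p * t)) - t)"
    by linarith
qed

text \<open>The substitution \<open>c z\<close> replaces \<open>G(z)\<close> by
  \<open>G(c z)\<close> in the equation, and the factor \<open>exp E\<close> adds
  \<open>z E'\<close>, which is the difference between \<open>H(z)\<close> and
  \<open>G(c z)\<close>.\<close>

lemma fps_compose_ode_exp:
  fixes F G H E :: "'a :: field_char_0 fps"
  assumes F: "fps_X * fps_deriv F = F * G" and E: "fps_nth E 0 = 0" "fps_X * fps_deriv E = H - (G oo (fps_const c * fps_X))"
  shows "fps_X * fps_deriv ((F oo (fps_const c * fps_X)) * (fps_exp 1 oo E))
     = ((F oo (fps_const c * fps_X)) * (fps_exp 1 oo E)) * H"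
proof -
  let ?U = "fps_const c * fps_X" and ?e = "fps_exp 1 oo E"
  have dF: "fps_X * fps_deriv (F oo ?U) = (F oo ?U) * (G oo ?U)"
  proof -
    have "fps_X * fps_deriv (F oo ?U) = (fps_X oo ?U) * (fps_deriv F oo ?U)"
      by (simp add: fps_compose_deriv mult_ac)
    also have "\<dots> = (fps_X * fps_deriv F) oo ?U" by (simp add: fps_compose_mult_distrib)
    also have "\<dots> = (F oo ?U) * (G oo ?U)" unfolding F by (simp add: fps_compose_mult_distrib)
    finally show ?thesis .
  qed
  have de: "fps_X * fps_deriv ?e = ?e * (H - (G oo ?U))"
    using E by (simp add: fps_compose_deriv mult.left_commute)
  have "fps_X * fps_deriv ((F oo ?U) * ?e)
      = (fps_X * fps_deriv (F oo ?U)) * ?e + (F oo ?U) * (fps_X * fps_deriv ?e)"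
    by (simp add: algebra_simps)
  also have "\<dots> = ((F oo ?U) * ?e) * H" unfolding dF de by (simp add: algebra_simps)
  finally show ?thesis .
qed

lemma fps_deriv_fps_expansion: "fps_deriv (fps_expansion f 0) = fps_expansion (deriv f) 0"
  by (rule fps_ext) (use taylor_coeff_deriv_fun[of f] in \<open>simp add: taylor_coeff_def\<close>)

section \<open>Majorants in the convex class compared with those of \<open>f0\<close>\<close>

context ma_minda_extremal
begin

text \<open>Write \<open>w(z) = c z + \<dots>\<close> for the Schwarz function of \<open>f\<close>. Then \<open>f'(z) = f0'(c z) exp E(z)\<close> with
  \<open>z E'(z) = \<psi>(w(z)) - \<psi>(c z)\<close>, and the coefficients of \<open>w(z) - c z\<close> are at most \<open>2 (1 - |c|)\<close>.\<close>

lemma classC_deriv_majorant: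
  assumes f: "classC \<psi> f"
  obtains a where "0 \<le> a" "a \<le> 1" "\<And>t. 0 \<le> t \<Longrightarrow> t \<le> 1 / 3 \<Longrightarrow>
    fps_bound t (fps_expansion (deriv f) 0)
      (maj (deriv f0) (a * t) * exp (2 * (1 - a) * Re (deriv \<psi> 0) * (t\<^sup>2 * (3 + t) / (6 * (1 - t) ^ 3))))"
proof -
  let ?\<phi> = "\<lambda>z. \<psi> z - 1"
  define d where "d = Re (deriv \<psi> 0)"
  have d0: "0 \<le> d" using mm by (simp add: d_def ma_minda_def)
  have holf: "f holomorphic_on ball 0 1" and f0: "deriv f 0 = 1"
    and nz: "\<And>z. z \<in> ball 0 1 \<Longrightarrow> deriv f z \<noteq> 0"
    using f by (auto simp: classC_def classA_def)
  obtain w where w: "schwarz_function w" "\<And>z. z \<in> ball 0 1 \<Longrightarrow> convexity_quotient f z = \<psi> (w z)"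
    using f by (auto simp: classC_def subordinate_def)
  have holw: "w holomorphic_on ball 0 1" and w0: "w 0 = 0" and wb: "\<And>z. cmod z < 1 \<Longrightarrow> cmod (w z) < 1"
    using w(1) by (auto simp: schwarz_function_def image_subset_iff)
  obtain v where v: "v holomorphic_on ball 0 1" "\<And>z. cmod z < 1 \<Longrightarrow> w z = z * v z" "deriv w 0 = v 0"
    using Schwarz3[OF holw w0] by auto
  have vb: "cmod (v z) \<le> 1" if "z \<in> ball 0 1" for z
  proof (cases "z = 0")
    case True
    then show ?thesis using Schwarz_Lemma(2)[OF holw w0 wb, of 0] v(3) by simp
  next
    case False
    then show ?thesis using Schwarz_Lemma(1)[OF holw w0 wb, of z] v(2)[of z] that by (simp add: norm_mult)
  qed
  define \<Phi> where "\<Phi> = fps_expansion ?\<phi> 0"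
  define V where "V = fps_expansion v 0"
  define W where "W = fps_expansion w 0"
  define a where "a = cmod (v 0)"
  define U where "U = fps_const (v 0) * fps_X"
  have a: "0 \<le> a" "a \<le> 1" using vb[of 0] by (auto simp: a_def)
  have W: "W = fps_X * V"
    unfolding W_def
  proof (rule fps_expansion_eqI)
    have "(\<lambda>z. z * v z) has_fps_expansion fps_X * V"
      unfolding V_def by (intro fps_expansion_intros disc_fps v)
    then show "w has_fps_expansion fps_X * V"
      by (rule has_fps_expansion_cong[THEN iffD1, rotated 2])
         (use v(2) eventually_nhds_in_open[of "ball 0 1" "0::complex"] in \<open>auto elim!: eventually_mono\<close>)
  qed
  have "(?\<phi> \<circ> w) has_fps_expansion (\<Phi> oo W)"
    unfolding \<Phi>_def W_def
    by (intro has_fps_expansion_compose disc_fps phi_holomorphic holw)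
       (use taylor_coeff_0[of w] w0 in \<open>simp add: taylor_coeff_def\<close>)
  then have Q: "fps_expansion (?\<phi> \<circ> w) 0 = \<Phi> oo W" by (rule fps_expansion_eqI)
  have hol\<phi>w: "(?\<phi> \<circ> w) holomorphic_on ball 0 1"
    by (rule holomorphic_on_compose_gen[OF holw phi_holomorphic]) (use wb in auto)
  have ode: "fps_X * fps_deriv (fps_expansion (deriv f) 0) = fps_expansion (deriv f) 0 * (\<Phi> oo W)"
    unfolding Q[symmetric] by (rule convex_ode_fps[OF holf nz _ hol\<phi>w]) (simp_all add: w(2))
  define D where "D = (\<Phi> oo W) - (\<Phi> oo U)"
  \<comment> \<open>At \<open>n = 0\<close> the division by 0 yields 0, which normalises
    \<open>E\<close>; \<open>D\<close> has no constant term, so \<open>z E' = D\<close> holds there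
    too.\<close>
  define E where "E = Abs_fps (\<lambda>n. fps_nth D n / of_nat n)"
  have E0: "fps_nth E 0 = 0" by (simp add: E_def)
  have XE: "fps_X * fps_deriv E = D"
  proof (rule fps_ext)
    fix n show "fps_nth (fps_X * fps_deriv E) n = fps_nth D n"
      by (cases n) (simp_all add: E_def D_def del: of_nat_Suc)
  qed
  let ?B = "fps_expansion (deriv f0) 0 oo U"
  have A: "fps_expansion (deriv f) 0 = ?B * (fps_exp 1 oo E)"
  proof (rule fps_ode_unique[OF ode])
    show "fps_X * fps_deriv (?B * (fps_exp 1 oo E)) = ?B * (fps_exp 1 oo E) * (\<Phi> oo W)"
      unfolding U_def
      by (rule fps_compose_ode_exp[of _ \<Phi>]) (use f0_fps_ode E0 XE in \<open>auto simp: \<Phi>_def D_def U_def\<close>)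
    show "fps_nth (\<Phi> oo W) 0 = 0" using phi_coeff[of 0] by (simp add: \<Phi>_def taylor_coeff_def)
    show "fps_nth (fps_expansion (deriv f) 0) 0 = fps_nth (?B * (fps_exp 1 oo E)) 0"
      using taylor_coeff_0[of "deriv f"] taylor_coeff_0[of "deriv f0"] f0 deriv_f0_0
      by (simp add: taylor_coeff_def)
  qed
  \<comment> \<open>The coefficients \<open>i d\<close> of \<psi> times the factors
    \<open>i t^(i - 1)\<close> of the power differences sum to at most
    \<open>d (1 + t) / (1 - t)^3\<close>; the last factor majorises \<open>W - U\<close>, that is
    \<open>z (v(z) - v(0))\<close>.\<close>
  have Dbound: "fps_bound t D (d * ((1 + t) / (1 - t) ^ 3) * (t * (2 * (1 - a) * t / (1 - t))))"
    if t: "0 \<le> t" "t \<le> 1 / 3" for t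
  proof (rule fps_bound_series[where F = \<Phi> and P = "\<lambda>i. W ^ i - U ^ i"])
    let ?c = "t * (2 * (1 - a) * t / (1 - t))"
    show "fps_nth D n = (\<Sum>i\<le>n. fps_nth \<Phi> i * fps_nth (W ^ i - U ^ i) n)" for n
      by (simp add: D_def fps_compose_nth atLeast0AtMost right_diff_distrib sum_subtractf)
    show "fps_bound t (W ^ i - U ^ i) (real i * t ^ (i - 1) * ?c)" for i
    proof (rule fps_bound_power_diff)
      \<comment> \<open>Bohr's inequality for \<open>v\<close> is what confines the majorant of
        \<open>w\<close> to \<open>t\<close>.\<close>
      have "fps_bound t W (t * 1)"
        unfolding W V_def by (intro fps_bound_mult fps_bound_X bohr_bounded) (use v vb t in auto)
      then show "fps_bound t W t" by simp
      have "fps_bound t U (a * t)"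
        unfolding U_def a_def by (intro fps_bound_mult fps_bound_const fps_bound_X t)
      moreover have "a * t \<le> t" using a t by (simp add: mult_left_le_one_le)
      ultimately show "fps_bound t U t" by (rule fps_bound_mono)
      have WU: "W - U = fps_X * (V - fps_const (v 0))" by (simp add: W U_def algebra_simps)
      have "fps_bound t (V - fps_const (v 0)) (2 * (1 - a) * t / (1 - t))"
        unfolding V_def a_def by (rule bounded_tail_fps_bound) (use v vb t in auto)
      from fps_bound_mult[OF fps_bound_X[OF t(1)] this t(1)]
      show "fps_bound t (W - U) ?c" unfolding WU .
    qed (rule t)
    fix N
    have c0: "0 \<le> ?c" using a t by simp
    have "(\<Sum>i\<le>N. cmod (fps_nth \<Phi> i) * (real i * t ^ (i - 1) * ?c))
        \<le> (\<Sum>i\<le>N. (real i * d) * (real i * t ^ (i - 1) * ?c))"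
    proof (rule sum_mono)
      fix i
      have "cmod (fps_nth \<Phi> i) \<le> real i * d"
        using phi_coeff[of i] ma_minda_coeff_le[OF mm, of i] by (cases "i = 0") (auto simp: \<Phi>_def taylor_coeff_def d_def)
      then show "cmod (fps_nth \<Phi> i) * (real i * t ^ (i - 1) * ?c) \<le> (real i * d) * (real i * t ^ (i - 1) * ?c)"
        by (rule mult_right_mono) (intro mult_nonneg_nonneg c0; use t in simp)
    qed
    also have "\<dots> = d * ?c * (\<Sum>i<N. (real i + 1)\<^sup>2 * t ^ i)"
      unfolding lessThan_Suc_atMost[symmetric] sum.lessThan_Suc_shift sum_distrib_left
      by (simp add: power2_eq_square mult_ac add_ac)
    also have "\<dots> \<le> d * ?c * ((1 + t) / (1 - t) ^ 3)"
      by (intro mult_left_mono sum_squares_power_le mult_nonneg_nonneg[OF d0 c0]) (use t in auto)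
    finally show "(\<Sum>i\<le>N. cmod (fps_nth \<Phi> i) * (real i * t ^ (i - 1) * ?c))
        \<le> d * ((1 + t) / (1 - t) ^ 3) * ?c" by (simp only: mult_ac)
  qed (rule t)
  \<comment> \<open>The bound for \<open>D\<close> divided by \<open>s\<close> contains
    \<open>s (1 + s) / (1 - s)^4\<close>, whose primitive vanishing at 0 is
    \<open>s^2 (3 + s) / (6 (1 - s)^3)\<close>.\<close>
  have Ebound: "fps_bound t E (2 * (1 - a) * d * (t\<^sup>2 * (3 + t) / (6 * (1 - t) ^ 3)))"
    if t: "0 \<le> t" "t \<le> 1 / 3" for t
  proof (rule fps_bound_integrate[where H' = "\<lambda>s. 2 * (1 - a) * d * (s * (1 + s) / (1 - s) ^ 4)"])
    fix s assume s: "0 < s" "s < t"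
    have "d * ((1 + s) / (1 - s) ^ 3) * (s * (2 * (1 - a) * s / (1 - s)))
       = s * (2 * (1 - a) * d * (s * (1 + s) / (1 - s) ^ 4))"
      using s t by (simp add: power_eq_if mult_ac)
    then show "fps_bound s (fps_X * fps_deriv E) (s * (2 * (1 - a) * d * (s * (1 + s) / (1 - s) ^ 4)))"
      unfolding XE using Dbound[of s] s t by simp
  next
    fix s assume s: "0 \<le> s" "s \<le> t"
    have "((\<lambda>t. t\<^sup>2 * (3 + t) / (6 * (1 - t) ^ 3)) has_real_derivative s * (1 + s) / (1 - s) ^ 4) (at s)"
    proof -
      have "(((2 * s * (3 + s) + s\<^sup>2) * (6 * (1 - s) ^ 3) - s\<^sup>2 * (3 + s) * (- 18 * (1 - s)\<^sup>2))
          / ((6 * (1 - s) ^ 3) * (6 * (1 - s) ^ 3))) = s * (1 + s) / (1 - s) ^ 4"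
      proof -
        define r where "r = 1 - s"
        have "s = 1 - r" "r \<noteq> 0" using s t by (auto simp: r_def)
        then show ?thesis unfolding r_def[symmetric]
          by (simp add: divide_simps) (simp add: algebra_simps power_eq_if)
      qed
      moreover have "((\<lambda>t. t\<^sup>2 * (3 + t) / (6 * (1 - t) ^ 3)) has_real_derivative
         ((2 * s * (3 + s) + s\<^sup>2) * (6 * (1 - s) ^ 3) - s\<^sup>2 * (3 + s) * (- 18 * (1 - s)\<^sup>2))
          / ((6 * (1 - s) ^ 3) * (6 * (1 - s) ^ 3))) (at s)"
        using s t by (auto intro!: derivative_eq_intros simp: algebra_simps)
      ultimately show ?thesis by simp
    qed
    from DERIV_cmult[OF this, of "2 * (1 - a) * d"]
    show "((\<lambda>t. 2 * (1 - a) * d * (t\<^sup>2 * (3 + t) / (6 * (1 - t) ^ 3))) has_real_derivative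
        2 * (1 - a) * d * (s * (1 + s) / (1 - s) ^ 4)) (at s)" by simp
  qed (use E0 t in auto)
  show ?thesis
  proof (rule that[OF a])
    fix t :: real assume t: "0 \<le> t" "t \<le> 1 / 3"
    have "fps_bound t ?B (maj (deriv f0) (a * t))"
    proof (rule fps_bound_compose)
      show "fps_bound t U (a * t)"
        unfolding U_def a_def by (intro fps_bound_mult fps_bound_const fps_bound_X t)
      fix N
      have at: "a * t \<le> 1 * (1 / 3)" "0 \<le> a * t" using a t mult_mono[of a 1 t "1 / 3"] by auto
      then show "(\<Sum>i\<le>N. cmod (fps_nth (fps_expansion (deriv f0) 0) i) * (a * t) ^ i) \<le> maj (deriv f0) (a * t)"
        using maj_fps_bound[OF deriv_f0_holomorphic, of "a * t"] by (simp add: fps_bound_def)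
    qed (rule t)
    then show "fps_bound t (fps_expansion (deriv f) 0)
      (maj (deriv f0) (a * t) * exp (2 * (1 - a) * Re (deriv \<psi> 0) * (t\<^sup>2 * (3 + t) / (6 * (1 - t) ^ 3))))"
      unfolding A using Ebound[OF t] by (intro fps_bound_mult fps_bound_exp t) (simp_all add: d_def)
  qed
qed

lemma deriv2_f0_0: "deriv (deriv f0) 0 = of_real (Re (deriv \<psi> 0))"
proof -
  have "of_nat 1 * taylor_coeff (deriv f0) 1 = (\<Sum>i<1. taylor_coeff (deriv f0) i * taylor_coeff (\<lambda>z. \<psi> z - 1) (1 - i))"
    unfolding taylor_coeff_def
    by (rule fps_ode_nth[OF f0_fps_ode]) (use phi_coeff[of 0] in \<open>auto simp: taylor_coeff_def\<close>)
  then have "deriv (deriv f0) 0 = taylor_coeff \<psi> 1"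
    by (simp add: deriv_f0_0 phi_coeff)
  then show ?thesis using mm by (simp add: complex_eq_iff ma_minda_def)
qed

lemma maj_split:
  assumes "\<bar>s\<bar> < 1"
  shows "maj (deriv f0) s = 1 + Re (deriv \<psi> 0) * s + (\<Sum>n. cmod (taylor_coeff (deriv f0) (n + 2)) * s ^ (n + 2))"
proof -
  have "0 \<le> Re (deriv \<psi> 0)" using mm by (simp add: ma_minda_def)
  then show ?thesis
    unfolding maj_def
    by (subst suminf_split_initial_segment[OF maj_summable[OF deriv_f0_holomorphic assms], of 2])
       (simp add: numeral_2_eq_2 deriv_f0_0 deriv2_f0_0)
qed

text \<open>With \<open>e\<close> the exponential, \<open>a^n e \<le> a e \<le> 1\<close> for
  \<open>n\<close> at least 1, so the factor \<open>e\<close> raises only the constant term. That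
  rise is weighed against the drop of the linear term in \<open>low_order_terms_bound\<close>; the
  higher terms are compared one by one.\<close>

lemma maj_deriv_compare:
  assumes a: "0 \<le> a" "a \<le> 1" and t: "0 \<le> t" "t \<le> 1 / 3"
  defines "d \<equiv> Re (deriv \<psi> 0)" and "P' \<equiv> t\<^sup>2 * (1 / 2 + 8 / 3 * t + 41 / 6 * t\<^sup>2 + 27 * t ^ 3)"
  shows "maj (deriv f0) (a * t) * exp (2 * (1 - a) * d * (t\<^sup>2 * (3 + t) / (6 * (1 - t) ^ 3)))
      \<le> maj (deriv f0) t + (1 - a) * d * (51 / 25 * P' - t)"
proof -
  have d: "0 \<le> d" "d \<le> 2" using mm ma_minda_deriv_le_2[OF mm] by (auto simp: d_def ma_minda_def)
  define S where "S = t\<^sup>2 * (3 + t) / (6 * (1 - t) ^ 3)"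
  note S = exponent_bounds[OF t, folded S_def]
  define e where "e = exp (2 * (1 - a) * d * S)"
  have low: "(e - 1) + d * t * (a * e - 1) \<le> (1 - a) * d * (51 / 25 * (S * (1 + d * t)) - t)"
    and ae: "a * e \<le> 1"
    using low_order_terms_bound[OF t d, of "1 - a" S] a S(1-3) by (simp_all add: e_def)
  define R where "R s = (\<Sum>n. cmod (taylor_coeff (deriv f0) (n + 2)) * s ^ (n + 2))" for s
  have at: "0 \<le> a * t" "a * t \<le> t" using a t by (auto simp: mult_left_le_one_le)
  have sm: "summable (\<lambda>n. cmod (taylor_coeff (deriv f0) (n + 2)) * s ^ (n + 2))" if "\<bar>s\<bar> < 1" for s
    using maj_summable[OF deriv_f0_holomorphic that] by (rule summable_ignore_initial_segment)
  have "R (a * t) * e \<le> R t"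
    unfolding R_def
  proof (subst suminf_mult2)
    show "(\<Sum>n. cmod (taylor_coeff (deriv f0) (n + 2)) * (a * t) ^ (n + 2) * e)
        \<le> (\<Sum>n. cmod (taylor_coeff (deriv f0) (n + 2)) * t ^ (n + 2))"
    proof (rule suminf_le)
      fix n
      have "a ^ (n + 2) * e \<le> a * e"
        using a power_decreasing[of 1 "n + 2" a] by (intro mult_right_mono) (auto simp: e_def)
      then have "a ^ (n + 2) * e \<le> 1" using ae by linarith
      then have "(cmod (taylor_coeff (deriv f0) (n + 2)) * t ^ (n + 2)) * (a ^ (n + 2) * e)
          \<le> (cmod (taylor_coeff (deriv f0) (n + 2)) * t ^ (n + 2)) * 1"
        using t by (intro mult_left_mono) auto
      then show "cmod (taylor_coeff (deriv f0) (n + 2)) * (a * t) ^ (n + 2) * e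
          \<le> cmod (taylor_coeff (deriv f0) (n + 2)) * t ^ (n + 2)"
        by (simp only: power_mult_distrib mult_ac mult_1_right)
    next
      show "summable (\<lambda>n. cmod (taylor_coeff (deriv f0) (n + 2)) * (a * t) ^ (n + 2) * e)"
        using at t by (intro summable_mult2 sm) auto
    qed (use t in \<open>intro sm, auto\<close>)
  qed (use at t in \<open>intro sm, auto\<close>)
  moreover have maj: "maj (deriv f0) (a * t) = 1 + d * (a * t) + R (a * t)" "maj (deriv f0) t = 1 + d * t + R t"
    using maj_split[of "a * t"] maj_split[of t] at t by (auto simp: R_def d_def)
  moreover have "maj (deriv f0) (a * t) * e = (e - 1) + d * t * (a * e - 1) + (1 + d * t) + R (a * t) * e"
    unfolding maj by (simp add: algebra_simps)
  moreover have "(1 - a) * d * (51 / 25 * (S * (1 + d * t)) - t) \<le> (1 - a) * d * (51 / 25 * P' - t)"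
  proof -
    have "S * (1 + d * t) \<le> S * (1 + 2 * t)"
      using S d t by (intro mult_left_mono add_left_mono mult_right_mono) auto
    then have "S * (1 + d * t) \<le> P'" using S(4) by (simp add: P'_def)
    then show ?thesis using a d by (intro mult_left_mono) auto
  qed
  ultimately have "maj (deriv f0) (a * t) * e \<le> maj (deriv f0) t + (1 - a) * d * (51 / 25 * P' - t)"
    using low by linarith
  then show ?thesis by (simp only: e_def S_def)
qed

lemma classC_maj_le:
  assumes f: "classC \<psi> f" and r: "0 \<le> r" "r \<le> 1 / 3"
  shows "maj f r \<le> maj f0 r"
proof -
  define d where "d = Re (deriv \<psi> 0)"
  have d: "0 \<le> d" using mm by (simp add: d_def ma_minda_def)
  obtain a where a: "0 \<le> a" "a \<le> 1" and bound: "\<And>t. 0 \<le> t \<Longrightarrow> t \<le> 1 / 3 \<Longrightarrow>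
    fps_bound t (fps_expansion (deriv f) 0)
      (maj (deriv f0) (a * t) * exp (2 * (1 - a) * d * (t\<^sup>2 * (3 + t) / (6 * (1 - t) ^ 3))))"
    using classC_deriv_majorant[OF f] unfolding d_def by metis
  define P where "P s = s ^ 3 / 6 + 2 / 3 * s ^ 4 + 41 / 30 * s ^ 5 + 9 / 2 * s ^ 6" for s :: real
  define P' where "P' s = s\<^sup>2 * (1 / 2 + 8 / 3 * s + 41 / 6 * s\<^sup>2 + 27 * s ^ 3)" for s :: real
  define H where "H s = maj f0 s + (1 - a) * d * (51 / 25 * P s - s\<^sup>2 / 2)" for s
  have dP: "(P has_real_derivative P' s) (at s)" for s
    unfolding P_def P'_def
    by (auto intro!: derivative_eq_intros simp: algebra_simps power_eq_if)
  have "fps_bound r (fps_expansion f 0) (H r)"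
  proof (rule fps_bound_integrate[where H' = "\<lambda>s. maj (deriv f0) s + (1 - a) * d * (51 / 25 * P' s - s)"])
    fix s assume s: "0 < s" "s < r"
    have "fps_bound s (fps_expansion (deriv f) 0) (maj (deriv f0) s + (1 - a) * d * (51 / 25 * P' s - s))"
      using bound[of s] maj_deriv_compare[OF a, of s] s r
      by (auto simp: d_def P'_def elim!: fps_bound_mono)
    then show "fps_bound s (fps_X * fps_deriv (fps_expansion f 0))
        (s * (maj (deriv f0) s + (1 - a) * d * (51 / 25 * P' s - s)))"
      unfolding fps_deriv_fps_expansion using s by (intro fps_bound_mult fps_bound_X) auto
  next
    fix s assume s: "0 \<le> s" "s \<le> r"
    have "((\<lambda>s. 51 / 25 * P s - s\<^sup>2 / 2) has_real_derivative 51 / 25 * P' s - s) (at s)"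
      using dP[of s] by (auto intro!: derivative_eq_intros)
    then show "(H has_real_derivative maj (deriv f0) s + (1 - a) * d * (51 / 25 * P' s - s)) (at s)"
      unfolding H_def
      by (intro DERIV_add maj_has_derivative f0_holomorphic DERIV_cmult) (use s r in auto)
  next
    show "fps_nth (fps_expansion f 0) 0 = 0"
      using taylor_coeff_0[of f] f by (simp add: taylor_coeff_def classC_def classA_def)
    show "H 0 = 0" by (simp add: H_def P_def maj_0 f0_0)
  qed (rule r)
  then have "maj f r \<le> H r" using r by (intro fps_bound_maj)
  moreover have "51 / 25 * P r \<le> r\<^sup>2 / 2"
  proof -
    have "P r = r\<^sup>2 * (r / 6 + 2 / 3 * r\<^sup>2 + 41 / 30 * r ^ 3 + 9 / 2 * r ^ 4)"
      by (simp add: P_def algebra_simps power_eq_if)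
    also have "\<dots> \<le> r\<^sup>2 * ((1 / 3) / 6 + 2 / 3 * (1 / 3)\<^sup>2 + 41 / 30 * (1 / 3) ^ 3 + 9 / 2 * (1 / 3) ^ 4)"
      using r by (intro mult_left_mono add_mono power_mono divide_right_mono) auto
    \<comment> \<open>25/102 is 1/2 divided by 51/25, and the bracket at 1/3 is about 0.236.\<close>
    also have "\<dots> \<le> r\<^sup>2 * (25 / 102)"
      by (intro mult_left_mono) (simp_all add: power_eq_if)
    finally show ?thesis by simp
  qed
  then have "(1 - a) * d * (51 / 25 * P r - r\<^sup>2 / 2) \<le> 0"
    using a d by (intro mult_nonneg_nonpos) auto
  ultimately show ?thesis by (simp add: H_def)
qed

end

text \<open>\<open>g' = \<omega> f'\<close> with \<open>|\<omega>| \<le> k\<close>, and up to 1/3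
  the majorant of \<omega> is still at most \<open>k\<close>; the product bound for the derivatives
  is then integrated from 0.\<close>

lemma dilatation_maj_le:
  assumes holf: "f holomorphic_on ball 0 1" and holg: "g holomorphic_on ball 0 1" and g0: "g 0 = 0"
    and nz: "\<And>z. z \<in> ball 0 1 \<Longrightarrow> deriv f z \<noteq> 0"
    and dil: "\<And>z. z \<in> ball 0 1 \<Longrightarrow> cmod (deriv g z / deriv f z) \<le> k"
    and r: "0 \<le> r" "r \<le> 1 / 3"
  shows "maj g r \<le> k * maj f r"
proof -
  have hol': "deriv f holomorphic_on ball 0 1" "deriv g holomorphic_on ball 0 1"
    using holf holg by (auto intro: holomorphic_deriv)
  define \<omega> where "\<omega> = (\<lambda>z. deriv g z / deriv f z)"
  have hol\<omega>: "\<omega> holomorphic_on ball 0 1"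
    unfolding \<omega>_def by (rule holomorphic_on_divide[OF hol'(2,1) nz])
  have "fps_expansion (deriv g) 0 = fps_expansion \<omega> 0 * fps_expansion (deriv f) 0"
  proof (rule fps_expansion_eqI)
    have "(\<lambda>z. \<omega> z * deriv f z) has_fps_expansion fps_expansion \<omega> 0 * fps_expansion (deriv f) 0"
      by (intro fps_expansion_intros disc_fps hol\<omega> hol')
    then show "deriv g has_fps_expansion fps_expansion \<omega> 0 * fps_expansion (deriv f) 0"
      by (rule has_fps_expansion_cong[THEN iffD1, rotated 2])
         (use nz eventually_nhds_in_open[of "ball 0 1" "0::complex"] in \<open>auto simp: \<omega>_def elim!: eventually_mono\<close>)
  qed
  note mult = this
  have k: "0 \<le> k" using dil[of 0] norm_ge_zero order_trans by (metis centre_in_ball zero_less_one)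
  have "fps_bound r (fps_expansion g 0) (k * maj f r - k * maj f 0)"
  proof (rule fps_bound_integrate[where H' = "\<lambda>s. k * maj (deriv f) s"])
    fix s assume s: "0 < s" "s < r"
    have "fps_bound s (fps_expansion (deriv g) 0) (k * maj (deriv f) s)"
      unfolding mult
      by (intro fps_bound_mult maj_fps_bound bohr_bounded hol\<omega> hol') (use s r dil in \<open>auto simp: \<omega>_def\<close>)
    then show "fps_bound s (fps_X * fps_deriv (fps_expansion g 0)) (s * (k * maj (deriv f) s))"
      unfolding fps_deriv_fps_expansion using s by (intro fps_bound_mult fps_bound_X) auto
  next
    fix s assume s: "0 \<le> s" "s \<le> r"
    have "(maj f has_real_derivative maj (deriv f) s) (at s)"
      by (rule maj_has_derivative[OF holf]) (use s r in auto)
    from DERIV_diff[OF DERIV_cmult[OF this, of k] DERIV_const]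
    show "((\<lambda>s. k * maj f s - k * maj f 0) has_real_derivative k * maj (deriv f) s) (at s)" by simp
  next
    show "fps_nth (fps_expansion g 0) 0 = 0"
      using taylor_coeff_0[of g] g0 by (simp add: taylor_coeff_def)
  qed (use r in auto)
  then have "maj g r \<le> k * maj f r - k * maj f 0" using r by (intro fps_bound_maj)
  moreover have "0 \<le> k * maj f 0" using k by (simp add: maj_0)
  ultimately show ?thesis by linarith
qed

section \<open>Bohr inequality\<close>

lemma hat_eq_maj:
  assumes "classA f" "\<bar>r\<bar> < 1"
  shows "hat f r = maj f r"
proof -
  have "f holomorphic_on ball 0 1" "f 0 = 0" "deriv f 0 = 1" using assms by (auto simp: classA_def)
  then show ?thesis
    unfolding hat_def maj_def
    by (subst suminf_split_initial_segment[OF maj_summable[OF _ assms(2)], of f 2])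
       (simp_all add: numeral_2_eq_2)
qed

lemma bohr_term_sums:
  assumes "f holomorphic_on ball 0 1" "g holomorphic_on ball 0 1" "f 0 = 0" "g 0 = 0" "\<bar>r\<bar> < 1"
  shows "bohr_term f g r sums (maj f r + maj g r)"
proof -
  have "(\<lambda>n. cmod (taylor_coeff u (Suc n)) * r ^ Suc n) sums maj u r"
    if "u holomorphic_on ball 0 1" "u 0 = 0" for u
    using summable_sums[OF maj_summable[OF that(1) assms(5)]] that(2)
    by (subst sums_Suc_iff) (simp add: maj_def)
  from sums_add[OF this[OF assms(1,3)] this[OF assms(2,4)]] show ?thesis
    by (simp add: bohr_term_def[abs_def] distrib_right)
qed

text \<open>Caratheodory's bound with \<open>Re (p 0) = 0\<close> annihilates all higher
  coefficients.\<close>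

lemma Re_zero_imp_const:
  assumes holo: "p holomorphic_on ball 0 1" and re: "\<And>z. z \<in> ball 0 1 \<Longrightarrow> Re (p z) = 0"
    and z: "z \<in> ball 0 1"
  shows "p z = p 0"
proof -
  have zero: "taylor_coeff p n = 0" if "n > 0" for n
    using caratheodory_coeff[OF holo _ that] re by simp
  have "(\<lambda>n. taylor_coeff p n * z ^ n) sums p 0"
    using sums_finite[of "{0}" "\<lambda>n. taylor_coeff p n * z ^ n"] zero by simp
  with taylor_sums[OF holo z] show ?thesis by (rule sums_unique2)
qed

text \<open>The normalisation \<open>f1'(0) = 1\<close> forces the Schwarz function to be the identity.\<close>

lemma normalised_harmonic_subordinate_eq:
  assumes h: "harmonic_decomp h f g" "classA f" and h1: "harmonic_decomp h1 f1 g1" "classA f1"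
    and sub: "subordinate h1 h" and z: "z \<in> ball 0 1"
  shows "f1 z = f z" "g1 z = g z"
proof -
  have hol: "f holomorphic_on ball 0 1" "g holomorphic_on ball 0 1"
    "f1 holomorphic_on ball 0 1" "g1 holomorphic_on ball 0 1"
    and zero: "f 0 = 0" "g 0 = 0" "f1 0 = 0" "g1 0 = 0" and d: "deriv f 0 = 1" "deriv f1 0 = 1"
    and hh: "\<And>z. z \<in> ball 0 1 \<Longrightarrow> h z = f z + cnj (g z)" "\<And>z. z \<in> ball 0 1 \<Longrightarrow> h1 z = f1 z + cnj (g1 z)"
    using h h1 by (auto simp: harmonic_decomp_def classA_def)
  obtain w where w: "schwarz_function w" "\<And>z. z \<in> ball 0 1 \<Longrightarrow> h1 z = h (w z)"
    using sub by (auto simp: subordinate_def)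
  have holw: "w holomorphic_on ball 0 1" and w0: "w 0 = 0" and wb: "\<And>z. cmod z < 1 \<Longrightarrow> cmod (w z) < 1"
    using w(1) by (auto simp: schwarz_function_def image_subset_iff)
  have holc: "(\<lambda>z. u (w z)) holomorphic_on ball 0 1" if "u holomorphic_on ball 0 1" for u
    using holomorphic_on_compose_gen[OF holw that] wb by (auto simp: o_def image_subset_iff)
  define a where "a = (\<lambda>z. f1 z - f (w z))"
  define b where "b = (\<lambda>z. g (w z) - g1 z)"
  have holab: "a holomorphic_on ball 0 1" "b holomorphic_on ball 0 1"
    unfolding a_def b_def
    by (rule holomorphic_on_diff[OF hol(3) holc[OF hol(1)]], rule holomorphic_on_diff[OF holc[OF hol(2)] hol(4)])
  have ab: "a z = cnj (b z)" if z: "z \<in> ball 0 1" for z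
  proof -
    have "f1 z + cnj (g1 z) = f (w z) + cnj (g (w z))"
      using w(2)[OF z] hh(1)[of "w z"] hh(2)[OF z] wb[of z] z by simp
    then show ?thesis by (simp add: a_def b_def algebra_simps)
  qed
  have eq0: "a z = 0 \<and> b z = 0" if z: "z \<in> ball 0 1" for z
  proof -
    \<comment> \<open>Uniqueness of the decomposition of a harmonic function: as \<open>a\<close> is
      the conjugate of \<open>b\<close>, both holomorphic functions have real part 0 and are
      constant.\<close>
    have holi: "(\<lambda>z. \<i> * (a z + b z)) holomorphic_on ball 0 1" "(\<lambda>z. a z - b z) holomorphic_on ball 0 1"
      by (intro holomorphic_intros holab)+
    have "\<i> * (a z + b z) = \<i> * (a 0 + b 0)"
      by (rule Re_zero_imp_const[OF holi(1) _ z]) (simp add: ab)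
    moreover have "a z - b z = a 0 - b 0"
      by (rule Re_zero_imp_const[OF holi(2) _ z]) (simp add: ab)
    ultimately show ?thesis using zero w0 by (simp add: a_def b_def)
  qed
  have "((\<lambda>z. f (w z)) has_field_derivative deriv f (w 0) * deriv w 0) (at 0)"
    by (rule DERIV_chain2) (use hol(1) holw w0 in \<open>auto intro!: holomorphic_derivI[of _ "ball 0 1"]\<close>)
  then have "(f1 has_field_derivative deriv f (w 0) * deriv w 0) (at 0)"
    by (rule DERIV_cong_ev[OF refl _ refl, THEN iffD1, rotated])
       (use eventually_nhds_in_open[of "ball 0 1" "0::complex"] eq0 in \<open>auto simp: a_def elim!: eventually_mono\<close>)
  then have dw: "deriv w 0 = 1" using d w0 by (simp add: DERIV_imp_deriv)
  then obtain \<alpha> where \<alpha>: "\<And>z. cmod z < 1 \<Longrightarrow> w z = \<alpha> * z"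
    using Schwarz_Lemma(3)[OF holw w0 wb, of 0] by auto
  have "deriv w 0 = \<alpha>"
  proof -
    have "((\<lambda>z. \<alpha> * z) has_field_derivative \<alpha>) (at 0)" by (auto intro!: derivative_eq_intros)
    then have "(w has_field_derivative \<alpha>) (at 0)"
      by (rule DERIV_cong_ev[OF refl _ refl, THEN iffD1, rotated])
         (use eventually_nhds_in_open[of "ball 0 1" "0::complex"] \<alpha> in \<open>auto elim!: eventually_mono\<close>)
    then show ?thesis by (rule DERIV_imp_deriv)
  qed
  then have "w z = z" using \<alpha>[of z] dw z by simp
  then show "f1 z = f z" "g1 z = g z" using eq0[OF z] by (auto simp: a_def b_def)
qed

lemma taylor_coeff_cmult:
  assumes "f holomorphic_on ball 0 1"
  shows "taylor_coeff (\<lambda>z. c * f z) n = c * taylor_coeff f n"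
proof -
  have "(\<lambda>z. c * f z) has_fps_expansion fps_const c * fps_expansion f 0"
    by (intro fps_expansion_intros disc_fps assms)
  then have "fps_expansion (\<lambda>z. c * f z) 0 = fps_const c * fps_expansion f 0"
    by (rule fps_expansion_eqI)
  then show ?thesis by (simp add: taylor_coeff_def)
qed

lemma maj_cmult:
  assumes "f holomorphic_on ball 0 1" "\<bar>r\<bar> < 1"
  shows "maj (\<lambda>z. c * f z) r = cmod c * maj f r"
  unfolding maj_def taylor_coeff_cmult[OF assms(1)] norm_mult mult.assoc
  by (rule suminf_mult[OF maj_summable[OF assms]])

text \<open>The mapping is \<open>f\<close> followed by the real-linear map
  \<open>u + k cnj u\<close>, which is invertible because \<open>k < 1\<close>; \<open>B\<close> is
  its inverse.\<close>

lemma qc_harmonic_affine: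
  assumes holf: "f holomorphic_on ball 0 1" and f0: "f 0 = 0" and inj: "inj_on f (ball 0 1)"
    and nz: "\<And>z. z \<in> ball 0 1 \<Longrightarrow> deriv f z \<noteq> 0"
    and K: "1 \<le> K" and k: "k = (K - 1) / (K + 1)"
  shows "qc_harmonic K (\<lambda>z. f z + of_real k * cnj (f z)) f (\<lambda>z. of_real k * f z)"
proof -
  have k01: "0 \<le> k" "k < 1" using K by (auto simp: k field_simps)
  then have k2: "k\<^sup>2 < 1" by (simp add: power_less_one_iff abs_square_less_1)
  have dg: "deriv (\<lambda>z. of_real k * f z) z = of_real k * deriv f z" if "z \<in> ball 0 1" for z
    using holomorphic_derivI[OF holf open_ball that] by (intro DERIV_imp_deriv DERIV_cmult)
  obtain g where g: "g holomorphic_on f ` ball 0 1" "\<And>z. z \<in> ball 0 1 \<Longrightarrow> g (f z) = z"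
    using holomorphic_has_inverse[OF holf open_ball inj] by metis
  let ?p = "\<lambda>z. f z + of_real k * cnj (f z)"
  define B where "B u = (u - of_real k * cnj u) / of_real (1 - k\<^sup>2)" for u :: complex
  have B: "B (?p z) = f z" for z
  proof -
    have "?p z - of_real k * cnj (?p z) = of_real (1 - k\<^sup>2) * f z"
      by (simp add: algebra_simps power2_eq_square)
    moreover have "complex_of_real (1 - k\<^sup>2) \<noteq> 0" using k2 by (simp only: of_real_eq_0_iff)
    ultimately show ?thesis unfolding B_def by simp
  qed
  have "homeomorphism (ball 0 1) (?p ` ball 0 1) ?p (\<lambda>u. g (B u))"
  proof (rule homeomorphismI)
    show "continuous_on (ball 0 1) ?p"
      by (intro continuous_intros holomorphic_on_imp_continuous_on holf)
    have "continuous_on (?p ` ball 0 1) B"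
      unfolding B_def
    proof (intro continuous_intros ballI)
      show "complex_of_real (1 - k\<^sup>2) \<noteq> 0" using k2 by (simp only: of_real_eq_0_iff)
    qed
    moreover have "B ` ?p ` ball 0 1 \<subseteq> f ` ball 0 1" using B by auto
    ultimately show "continuous_on (?p ` ball 0 1) (\<lambda>u. g (B u))"
      by (intro continuous_on_compose2[OF holomorphic_on_imp_continuous_on[OF g(1)]])
  qed (use B g(2) in auto)
  moreover have "0 < (cmod (deriv f z))\<^sup>2 - (cmod (of_real k * deriv f z))\<^sup>2" if "z \<in> ball 0 1" for z
  proof -
    have "(cmod (deriv f z))\<^sup>2 - (cmod (of_real k * deriv f z))\<^sup>2 = (1 - k\<^sup>2) * (cmod (deriv f z))\<^sup>2"
      by (simp add: norm_mult power_mult_distrib algebra_simps)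
    then show ?thesis using k2 nz[OF that] by simp
  qed
  moreover have "cmod (of_real k * deriv f z / deriv f z) \<le> (K - 1) / (K + 1)" if "z \<in> ball 0 1" for z
    using nz[OF that] k01 unfolding k[symmetric] by simp
  ultimately show ?thesis
    unfolding qc_harmonic_def harmonic_decomp_def sense_preserving_def
    using holf f0 dg by (auto intro!: holomorphic_intros)
qed

section \<open>The Bohr radius, the inequality and its sharpness\<close>

context ma_minda_extremal
begin

lemma f0_classA: "classA f0"
  using ext by (simp add: convex_extremal_def)

lemma maj_f0_ge: "0 \<le> r \<Longrightarrow> r < 1 \<Longrightarrow> r \<le> maj f0 r"
proof -
  assume r: "0 \<le> r" "r < 1"
  have "0 \<le> (\<Sum>m. cmod (taylor_coeff f0 (m + 2)) * r ^ (m + 2))"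
    using r by (intro suminf_nonneg summable_ignore_initial_segment maj_summable f0_holomorphic) auto
  then show "r \<le> maj f0 r"
    unfolding hat_eq_maj[OF f0_classA, of r, symmetric] using r hat_eq_maj[OF f0_classA, of r]
    by (simp add: hat_def)
qed

lemma maj_f0_strict_mono:
  assumes "0 \<le> r" "r < s" "s < 1"
  shows "maj f0 r < maj f0 s"
proof (rule DERIV_pos_imp_increasing[OF assms(2)])
  fix t assume t: "r \<le> t" "t \<le> s"
  have "0 < maj (deriv f0) t"
    unfolding maj_def
    by (rule suminf_pos2[where i = 0, OF maj_summable[OF deriv_f0_holomorphic]])
       (use t assms deriv_f0_0 in auto)
  then show "\<exists>y. (maj f0 has_real_derivative y) (at t) \<and> 0 < y"
    using maj_has_derivative[OF f0_holomorphic, of t] t assms by auto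
qed

lemma bohr_root_iff: "bohr_root K f0 r \<longleftrightarrow> 0 < r \<and> r < 1 \<and> 2 * K / (K + 1) * maj f0 r = minor_end"
proof (cases "0 < r \<and> r < 1")
  case True
  then have "hat f0 r = maj f0 r" by (intro hat_eq_maj f0_classA) auto
  then show ?thesis
    unfolding bohr_root_def value_at_minus_one_f0 by (simp only: minus_minus of_real_eq_iff)
qed (auto simp: bohr_root_def)

text \<open>As \<open>maj f0 r \<ge> r\<close> and the factor is at least 1, the left side has
  reached \<open>minor_end\<close> by \<open>r = minor_end < 1\<close>. The intermediate value
  theorem therefore works on a compact subinterval, away from 1.\<close>

lemma bohr_root_ex1:
  assumes K: "1 \<le> K"
  shows "\<exists>!r. bohr_root K f0 r"
proof -
  define c where "c = 2 * K / (K + 1)"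
  have c: "1 \<le> c" using K by (simp add: c_def field_simps)
  have M: "0 < minor_end" "minor_end < 1"
    using minor_less_end[of 0] minor_0 minor_end_less_1 by auto
  have "\<exists>r\<ge>0. r \<le> minor_end \<and> c * maj f0 r = minor_end"
  proof (rule IVT')
    show "c * maj f0 0 \<le> minor_end" using M by (simp add: maj_0 f0_0)
    have "minor_end \<le> 1 * maj f0 minor_end" using maj_f0_ge[of minor_end] M by simp
    also have "\<dots> \<le> c * maj f0 minor_end"
      using c maj_f0_ge[of minor_end] M by (intro mult_right_mono) auto
    finally show "minor_end \<le> c * maj f0 minor_end" .
    have "(maj f0 has_real_derivative maj (deriv f0) x) (at x within {0..minor_end})"
      if "x \<in> {0..minor_end}" for x
      by (rule has_field_derivative_at_within[OF maj_has_derivative[OF f0_holomorphic]]) (use that M in auto)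
    then have "continuous_on {0..minor_end} (maj f0)"
      by (rule DERIV_continuous_on)
    then show "continuous_on {0..minor_end} (\<lambda>r. c * maj f0 r)" by (intro continuous_intros)
  qed (use M in simp)
  then obtain r where r: "0 \<le> r" "r \<le> minor_end" "c * maj f0 r = minor_end" by auto
  show ?thesis
  proof (rule ex1I[of _ r])
    have "r \<noteq> 0" using r M by (auto simp: maj_0 f0_0)
    then show "bohr_root K f0 r" unfolding bohr_root_iff using r M by (auto simp: c_def)
    fix s assume "bohr_root K f0 s"
    then have s: "0 < s" "s < 1" "c * maj f0 s = minor_end" by (auto simp: bohr_root_iff c_def)
    then have "maj f0 s = maj f0 r" using r(3) c by (metis mult_left_cancel not_one_le_zero)
    then show "s = r" using maj_f0_strict_mono[of s r] maj_f0_strict_mono[of r s] r s M by force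
  qed
qed

lemma bohr_inequality:
  assumes K: "1 \<le> K" and root: "bohr_root K f0 r0"
    and h: "qc_harmonic K h f g" "classC \<psi> f" and h1: "harmonic_decomp h1 f1 g1" "classA f1"
    and sub: "subordinate h1 h" and r: "0 \<le> r" "r \<le> min r0 (1 / 3)"
  shows "summable (bohr_term f1 g1 r)" "(\<Sum>m. bohr_term f1 g1 r m) \<le> boundary_dist f"
proof -
  define k where "k = (K - 1) / (K + 1)"
  \<comment> \<open>\<open>1 + k\<close>, the cost of adding the co-analytic part, is exactly the
    factor in the root equation.\<close>
  have k: "0 \<le> k" "1 + k = 2 * K / (K + 1)" using K by (auto simp: k_def field_simps)
  have A: "classA f" and nz: "\<And>z. z \<in> ball 0 1 \<Longrightarrow> deriv f z \<noteq> 0"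
    using h(2) by (auto simp: classC_def)
  have dec: "harmonic_decomp h f g" and dil: "\<And>z. z \<in> ball 0 1 \<Longrightarrow> cmod (deriv g z / deriv f z) \<le> k"
    using h(1) by (auto simp: qc_harmonic_def k_def)
  have hol: "f holomorphic_on ball 0 1" "g holomorphic_on ball 0 1" "f 0 = 0" "g 0 = 0"
    using dec A by (auto simp: harmonic_decomp_def classA_def)
  have "taylor_coeff f1 n = taylor_coeff f n" "taylor_coeff g1 n = taylor_coeff g n" for n
    using normalised_harmonic_subordinate_eq[OF dec A h1 sub] by (auto intro!: taylor_coeff_cong)
  then have "bohr_term f1 g1 r = bohr_term f g r" by (simp add: bohr_term_def fun_eq_iff)
  moreover have "bohr_term f g r sums (maj f r + maj g r)"
    by (rule bohr_term_sums) (use hol r in auto)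
  ultimately have sums: "bohr_term f1 g1 r sums (maj f r + maj g r)" by simp
  then show "summable (bohr_term f1 g1 r)" by (rule sums_summable)
  have "maj f r + maj g r \<le> maj f r + k * maj f r"
    using dilatation_maj_le[OF hol(1,2,4) nz dil] r by simp
  also have "\<dots> = (1 + k) * maj f r" by (simp add: algebra_simps)
  also have "\<dots> \<le> (1 + k) * maj f0 r"
    using classC_maj_le[OF h(2), of r] r k by (intro mult_left_mono) auto
  also have "\<dots> \<le> (1 + k) * maj f0 r0"
    using maj_f0_strict_mono[of r r0] r k root
    by (intro mult_left_mono) (cases "r = r0"; auto simp: bohr_root_iff)+
  also have "\<dots> = minor_end" using root k by (simp add: bohr_root_iff)
  also have "\<dots> \<le> boundary_dist f" by (rule classC_boundary_dist[OF h(2)])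
  finally show "(\<Sum>m. bohr_term f1 g1 r m) \<le> boundary_dist f" using sums_unique[OF sums] by simp
qed

lemma bohr_sharp:
  assumes K: "1 \<le> K" and k: "k = (K - 1) / (K + 1)" and root: "bohr_root K f0 r0"
  defines "g0 \<equiv> (\<lambda>z. of_real k * f0 z)"
  shows "bohr_term f0 g0 r0 sums boundary_dist f0"
    and "\<And>r. r0 < r \<Longrightarrow> r < 1 \<Longrightarrow>
      summable (bohr_term f0 g0 r) \<and> boundary_dist f0 < (\<Sum>m. bohr_term f0 g0 r m)"
proof -
  have k1: "0 \<le> k" "1 + k = 2 * K / (K + 1)" using K by (auto simp: k field_simps)
  have r0: "0 < r0" "r0 < 1" "(1 + k) * maj f0 r0 = boundary_dist f0"
    using root k1 by (auto simp: bohr_root_iff boundary_dist_f0)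
  have sums: "bohr_term f0 g0 r sums ((1 + k) * maj f0 r)" if "0 < r" "r < 1" for r
  proof -
    have "bohr_term f0 g0 r sums (maj f0 r + maj g0 r)"
      unfolding g0_def by (rule bohr_term_sums) (use that f0_holomorphic f0_0 in \<open>auto intro!: holomorphic_intros\<close>)
    moreover have "maj g0 r = k * maj f0 r"
      unfolding g0_def using maj_cmult[OF f0_holomorphic, of r "of_real k"] that k1 by simp
    ultimately show ?thesis by (simp add: algebra_simps)
  qed
  show "bohr_term f0 g0 r0 sums boundary_dist f0" using sums[OF r0(1,2)] r0(3) by simp
  fix r assume r: "r0 < r" "r < 1"
  have s: "bohr_term f0 g0 r sums ((1 + k) * maj f0 r)" using sums r r0 by simp
  have "(1 + k) * maj f0 r0 < (1 + k) * maj f0 r"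
    using maj_f0_strict_mono[of r0 r] r r0 k1 by (intro mult_strict_left_mono) auto
  then show "summable (bohr_term f0 g0 r) \<and> boundary_dist f0 < (\<Sum>m. bohr_term f0 g0 r m)"
    using sums_summable[OF s] sums_unique[OF s] r0(3) by simp
qed

end

theorem theorem2p8:
  fixes \<psi> f0 :: "complex \<Rightarrow> complex" and K k :: real
  assumes "ma_minda \<psi>"
    and "K \<ge> 1"
    and "k = (K - 1) / (K + 1)"
    and "convex_extremal \<psi> f0"
  shows "(\<exists>L. ((\<lambda>r::real. f0 (- of_real r)) \<longlongrightarrow> L) (at_left 1)) \<and>
    (\<exists>!r. bohr_root K f0 r) \<and>
    (\<forall>r0. bohr_root K f0 r0 \<longrightarrow>
      (\<forall>h f g h1 f1 g1 r.
         qc_harmonic K h f g \<and> classC \<psi> f \<and>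
         harmonic_decomp h1 f1 g1 \<and> classA f1 \<and> subordinate h1 h \<and>
         0 \<le> r \<and> r \<le> min r0 (1 / 3) \<longrightarrow>
         summable (bohr_term f1 g1 r) \<and> (\<Sum>m. bohr_term f1 g1 r m) \<le> boundary_dist f) \<and>
      ((\<forall>r. 0 \<le> r \<and> r < 1 \<longrightarrow> of_real (hat f0 r) = f0 (of_real r)) \<and> min r0 (1 / 3) = r0 \<longrightarrow>
        (let g0 = (\<lambda>z. of_real k * f0 z);
             p = (\<lambda>z. f0 z + of_real k * cnj (f0 z))
         in qc_harmonic K p f0 g0 \<and> classC \<psi> f0 \<and> subordinate p p \<and>
            bohr_term f0 g0 r0 sums boundary_dist f0 \<and>
            (\<forall>r. r0 < r \<and> r < 1 \<longrightarrow>
               summable (bohr_term f0 g0 r) \<and>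
               boundary_dist f0 < (\<Sum>m. bohr_term f0 g0 r m)))))"
proof -
  interpret ma_minda_extremal \<psi> f0 using assms by unfold_locales
  have refl: "subordinate p p" for p
    unfolding subordinate_def schwarz_function_def
    by (auto intro!: exI[of _ "\<lambda>z. z"] holomorphic_intros)
  show ?thesis
    unfolding Let_def
  proof (intro conjI allI impI)
    show "\<exists>L. ((\<lambda>r::real. f0 (- of_real r)) \<longlongrightarrow> L) (at_left 1)"
      using f0_tendsto by (rule exI)
    show "\<exists>!r. bohr_root K f0 r" by (rule bohr_root_ex1[OF assms(2)])
    fix r0 assume root: "bohr_root K f0 r0"
    show "qc_harmonic K (\<lambda>z. f0 z + of_real k * cnj (f0 z)) f0 (\<lambda>z. of_real k * f0 z)"
      by (rule qc_harmonic_affine[OF f0_holomorphic f0_0 classC_univalent_growth(1)[OF f0_classC]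
            deriv_f0_nonzero assms(2,3)])
    show "classC \<psi> f0" by (rule f0_classC)
    show "subordinate p p" for p by (rule refl)
    show "bohr_term f0 (\<lambda>z. of_real k * f0 z) r0 sums boundary_dist f0"
      by (rule bohr_sharp(1)[OF assms(2,3) root])
    show "summable (bohr_term f0 (\<lambda>z. of_real k * f0 z) r)"
      "boundary_dist f0 < (\<Sum>m. bohr_term f0 (\<lambda>z. of_real k * f0 z) r m)" if "r0 < r \<and> r < 1" for r
      using bohr_sharp(2)[OF assms(2,3) root] that by blast+
    fix h f g h1 f1 g1 r
    assume "qc_harmonic K h f g \<and> classC \<psi> f \<and> harmonic_decomp h1 f1 g1 \<and> classA f1 \<and>
      subordinate h1 h \<and> 0 \<le> r \<and> r \<le> min r0 (1 / 3)"
    then show "summable (bohr_term f1 g1 r)" "(\<Sum>m. bohr_term f1 g1 r m) \<le> boundary_dist f"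
      using bohr_inequality[OF assms(2) root] by blast+
  qed
qed

end
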